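(* Let $d\ge 1$, let $W(t)$, $t\ge0$, be a $d$-dimensional Wiener process with $W(0)=0$, and let $$Y_t=W(t)\cdot\int_0^tW(s)\,ds-\frac12\int_0^t|W(s)|^2\,ds.$$ Then, almost surely, there exists an unbounded increasing sequence of times $t_n$ for which $Y_{t_n}=0$.
   Context: A $d$-dimensional Wiener process is a standard Brownian motion in $\mathbb{R}^d$ with independent components and continuous paths; $\cdot$ and $|\cdot|$ are the Euclidean inner product and norm. *)

theory Defs
  imports "HOL-Probability.Probability"
begin

text \<open>
  Time is the half-line \<open>{0..}\<close>; values of a process at negative arguments are never used.
  The initial value and path continuity are only required almost surely, so a process all of whose
  paths start at 0 and are continuous is covered.
\<close>

locale real_wiener_process = prob_space M for M :: "'w measure" +
  fixes B :: "real \<Rightarrow> 'w \<Rightarrow> real"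
  assumes measurable_at: "0 \<le> t \<Longrightarrow> B t \<in> borel_measurable M"
    and starts_at_zero: "AE \<omega> in M. B 0 \<omega> = 0"
    and independent_increments:
      "\<lbrakk>0 \<le> ts 0; \<And>k. k < n \<Longrightarrow> ts k \<le> ts (Suc k)\<rbrakk> \<Longrightarrow>
        indep_vars (\<lambda>_. borel) (\<lambda>k \<omega>. B (ts (Suc k)) \<omega> - B (ts k) \<omega>) {..<n::nat}"
    and normal_increments:
      "\<lbrakk>0 \<le> s; s < t\<rbrakk> \<Longrightarrow>
        distributed M lborel (\<lambda>\<omega>. B t \<omega> - B s \<omega>) (normal_density 0 (sqrt (t - s)))"
    and continuous_paths: "AE \<omega> in M. continuous_on {0..} (\<lambda>t. B t \<omega>)"

text \<open>
  The components are independent as processes: each of them is regarded as a single random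
  element of the product space of real functions on \<open>{0..}\<close>.
\<close>

locale wiener_process = prob_space M for M :: "'w measure" +
  fixes W :: "real \<Rightarrow> 'w \<Rightarrow> real ^ 'd"
  assumes wiener_components: "real_wiener_process M (\<lambda>t \<omega>. W t \<omega> $ i)"
    and independent_components:
      "indep_vars (\<lambda>_. PiM {0..} (\<lambda>_. borel)) (\<lambda>i \<omega>. \<lambda>t\<in>{0..}. W t \<omega> $ i) UNIV"

definition Y_process :: "(real \<Rightarrow> 'w \<Rightarrow> real ^ 'd) \<Rightarrow> real \<Rightarrow> 'w \<Rightarrow> real" where
  "Y_process W t \<omega> =
     W t \<omega> \<bullet> integral {0..t} (\<lambda>s. W s \<omega>) - 1 / 2 * integral {0..t} (\<lambda>s. (norm (W s \<omega>))\<^sup>2)"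

end

theory Submission
  imports Defs "HOL-Real_Asymp.Real_Asymp"
begin

text \<open>
  The functional \<open>Y\<close> splits into one summand per coordinate, and for a path \<open>f\<close> with \<open>f 0 = 0\<close> and
  \<open>v u = f (s + u) - f s\<close>, the value at time \<open>s + h\<close> differs from the same functional of the increment
  path \<open>v\<close> on \<open>{0..h}\<close> only by \<open>o(h\<^sup>2)\<close> in probability. Hence one can choose times
  \<open>t\<^sub>0 < t\<^sub>1 < \<dots>\<close> growing so fast that \<open>Y\<close> at time \<open>t\<^sub>n\<^sub>+\<^sub>1\<close> is, up to an error that is eventually
  small against \<open>(t\<^sub>n\<^sub>+\<^sub>1 - t\<^sub>n)\<^sup>2\<close>, a Riemann sum of increments over \<open>[t\<^sub>n, t\<^sub>n\<^sub>+\<^sub>1]\<close>. These are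
  independent in \<open>n\<close> and in the coordinate, and after scaling by \<open>(t\<^sub>n\<^sub>+\<^sub>1 - t\<^sub>n)\<^sup>2\<close> each exceeds a
  positive constant, and lies below a negative one, with probability bounded away from 0 uniformly in
  the mesh. By the Borel zero-one law \<open>Y\<close> is positive and negative at arbitrarily large times, so
  continuity gives the zeros.
\<close>

subsection \<open>Riemann sums of the path functional\<close>

text \<open>Each cell adds an error of at most \<open>e * d\<close>, because \<open>g\<close> stays
  within \<open>e\<close> of its value at the right end of the cell. Only \<open>j\<close> cells of
  the larger interval \<open>{0..h}\<close> are summed, so that induction on \<open>j\<close> goes
  through with \<open>h\<close> fixed.\<close>

lemma riemann_sum_error:
  fixes g :: "real \<Rightarrow> real"
  assumes cont: "continuous_on {0..h} g" and d: "0 < d"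
    and e: "\<And>x y. x \<in> {0..h} \<Longrightarrow> y \<in> {0..h} \<Longrightarrow> \<bar>x - y\<bar> \<le> d \<Longrightarrow> \<bar>g x - g y\<bar> \<le> e"
    and j: "real j * d \<le> h"
  shows "\<bar>integral {0..real j * d} g - d * (\<Sum>k=1..j. g (real k * d))\<bar> \<le> e * (real j * d)"
  using j
proof (induction j)
  case 0
  then show ?case by simp
next
  case (Suc j)
  let ?a = "real j * d" and ?b = "real (Suc j) * d"
  have ab: "0 \<le> ?a" "?a \<le> ?b" "?b \<le> h" and bd: "?b - ?a = d"
    using d Suc.prems by (auto simp: algebra_simps)
  have int: "g integrable_on {0..?b}"
    using ab by (intro integrable_continuous_real continuous_on_subset[OF cont]) auto
  have c: "continuous_on {?a..?b} g"
    using ab by (intro continuous_on_subset[OF cont]) (simp only: atLeastatMost_subset_iff simp_thms)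
  have "norm (integral {?a..?b} (\<lambda>x. g x - g ?b)) \<le> e * (?b - ?a)"
  proof (rule integral_bound)
    show "continuous_on {?a..?b} (\<lambda>x. g x - g ?b)"
      by (intro continuous_intros c)
    fix t assume t: "t \<in> {?a..?b}"
    have "?a \<le> t" "t \<le> ?b" using t by auto
    with ab bd have "t \<in> {0..h}" "?b \<in> {0..h}" "\<bar>t - ?b\<bar> \<le> d"
      unfolding atLeastAtMost_iff abs_le_iff by linarith+
    then show "norm (g t - g ?b) \<le> e"
      unfolding real_norm_def by (rule e)
  qed (use ab in auto)
  moreover have "integral {?a..?b} (\<lambda>x. g x - g ?b) = integral {?a..?b} g - d * g ?b"
    using ab(2) bd
    by (simp only: integral_diff[OF integrable_continuous_real[OF c] integrable_const_ivl]
        integral_const_real measure_lborel_Icc real_scaleR_def)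
  moreover have "integral {0..?a} g + integral {?a..?b} g = integral {0..?b} g"
    using ab int by (intro Henstock_Kurzweil_Integration.integral_combine) auto
  moreover have "\<bar>integral {0..?a} g - d * (\<Sum>k=1..j. g (real k * d))\<bar> \<le> e * ?a"
    using ab by (intro Suc.IH) auto
  moreover have "e * ?b = e * ?a + e * d"
    by (simp add: algebra_simps)
  moreover have "d * (\<Sum>k=1..Suc j. g (real k * d)) = d * (\<Sum>k=1..j. g (real k * d)) + d * g ?b"
    by (simp add: algebra_simps)
  ultimately show ?case
    unfolding bd real_norm_def by linarith
qed

lemma riemann_sum_tendsto_integral:
  fixes g :: "real \<Rightarrow> real"
  assumes h: "0 < h" and cont: "continuous_on {0..h} g"
  shows "(\<lambda>m. h / real m * (\<Sum>k=1..m. g (real k * (h / real m)))) \<longlonglongrightarrow> integral {0..h} g"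
proof (rule LIMSEQ_I)
  fix r :: real assume r: "0 < r"
  \<comment> \<open>With this oscillation bound the error over total length \<open>h\<close> is
    \<open>r / 2\<close>.\<close>
  define e where "e = r / (2 * h)"
  have "0 < e" using r h by (simp add: e_def)
  have "uniformly_continuous_on {0..h} g"
    using cont by (intro compact_uniformly_continuous) auto
  then obtain \<delta> where \<delta>: "0 < \<delta>"
    and u: "\<And>x y. x \<in> {0..h} \<Longrightarrow> y \<in> {0..h} \<Longrightarrow> dist y x < \<delta> \<Longrightarrow> dist (g y) (g x) < e"
    using \<open>0 < e\<close> unfolding uniformly_continuous_on_def by metis
  obtain N :: nat where N: "h / \<delta> < real N" using reals_Archimedean2 by blast
  show "\<exists>no. \<forall>n\<ge>no. norm (h / real n * (\<Sum>k=1..n. g (real k * (h / real n))) - integral {0..h} g) < r"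
  proof (intro exI[of _ "Suc N"] allI impI)
    fix m assume m: "Suc N \<le> m"
    then have m0: "0 < real m" "h / \<delta> < real m" using N by linarith+
    have d: "0 < h / real m" "h / real m < \<delta>"
      using m0 h \<delta> by (auto simp: field_simps)
    have "\<bar>integral {0..real m * (h / real m)} g - h / real m * (\<Sum>k=1..m. g (real k * (h / real m)))\<bar>
        \<le> e * (real m * (h / real m))"
    proof (rule riemann_sum_error[OF cont d(1)])
      fix x y assume xy: "x \<in> {0..h}" "y \<in> {0..h}" "\<bar>x - y\<bar> \<le> h / real m"
      then have "dist y x < \<delta>" using d(2) by (simp add: dist_real_def)
      with u[OF xy(1,2)] show "\<bar>g x - g y\<bar> \<le> e" by (simp add: dist_real_def)
    qed (use m0 in auto)
    moreover have "real m * (h / real m) = h" using m0 by simp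
    moreover have "e * h < r" using h r by (simp add: e_def)
    ultimately show "norm (h / real m * (\<Sum>k=1..m. g (real k * (h / real m))) - integral {0..h} g) < r"
      by (simp add: abs_minus_commute)
  qed
qed

section \<open>The functional of one coordinate: discrete, continuous and sampled\<close>

definition walk_functional :: "(nat \<Rightarrow> real) \<Rightarrow> nat \<Rightarrow> real" where
  "walk_functional S m =
     S m * ((\<Sum>k=1..m. S k) / real m) - (\<Sum>k=1..m. (S k)\<^sup>2) / (2 * real m)"

text \<open>One coordinate of \<open>Y\<close> at time \<open>h\<close> for the path restarted at
  time \<open>s\<close>; if \<open>f 0 = 0\<close>, then \<open>path_functional f 0 t\<close> is the
  summand of \<open>Y\<close> at time \<open>t\<close> that belongs to \<open>f\<close>.\<close>

definition path_functional :: "(real \<Rightarrow> real) \<Rightarrow> real \<Rightarrow> real \<Rightarrow> real" where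
  "path_functional f s h =
     (f (s + h) - f s) * integral {0..h} (\<lambda>u. f (s + u) - f s)
       - 1 / 2 * integral {0..h} (\<lambda>u. (f (s + u) - f s)\<^sup>2)"

text \<open>The replacement of both integrals by right-endpoint Riemann sums of mesh
  \<open>h / m\<close>. \<open>walk_functional\<close> takes averages over the \<open>m\<close>
  sample points, so a single factor \<open>h\<close> turns both averages into Riemann sums.\<close>

definition sampled_functional :: "(real \<Rightarrow> real) \<Rightarrow> real \<Rightarrow> real \<Rightarrow> nat \<Rightarrow> real" where
  "sampled_functional f s h m =
     h * walk_functional (\<lambda>k. f (s + real k * (h / real m)) - f s) m"

lemma sampled_functional_tendsto:
  assumes h: "0 < h" and s: "0 \<le> s" and cont: "continuous_on {0..} f"
  shows "sampled_functional f s h \<longlonglongrightarrow> path_functional f s h"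
proof -
  let ?v = "\<lambda>u. f (s + u) - f s"
  have v: "continuous_on {0..h} ?v"
    using s by (intro continuous_intros continuous_on_compose2[OF cont]) auto
  have "(\<lambda>m. ?v h * (h / real m * (\<Sum>k=1..m. ?v (real k * (h / real m))))
      - 1 / 2 * (h / real m * (\<Sum>k=1..m. (?v (real k * (h / real m)))\<^sup>2)))
    \<longlonglongrightarrow> ?v h * integral {0..h} ?v - 1 / 2 * integral {0..h} (\<lambda>u. (?v u)\<^sup>2)"
    by (intro tendsto_intros riemann_sum_tendsto_integral h v continuous_on_power)
  moreover have "\<forall>\<^sub>F m in sequentially.
      ?v h * (h / real m * (\<Sum>k=1..m. ?v (real k * (h / real m))))
        - 1 / 2 * (h / real m * (\<Sum>k=1..m. (?v (real k * (h / real m)))\<^sup>2))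
      = sampled_functional f s h m"
    using eventually_gt_at_top[of 0]
  proof eventually_elim
    case (elim m)
    then have "real m * (h / real m) = h" by simp
    then show ?case
      by (simp only: sampled_functional_def walk_functional_def) (simp add: field_simps)
  qed
  ultimately show ?thesis
    unfolding path_functional_def by (rule Lim_transform_eventually)
qed

text \<open>
  The linear term in the increments after time \<open>s\<close> that one would expect from the integral of \<open>f\<^sup>2\<close>
  cancels, so the correction involves the later path only through \<open>f (s + h) - f s\<close>.
\<close>

lemma path_functional_shift:
  assumes h: "0 \<le> h" and s: "0 \<le> s" and cont: "continuous_on {0..} f" and f0: "f 0 = 0"
  shows "path_functional f 0 (s + h) = path_functional f s h + path_functional f 0 s
      + 1 / 2 * h * (f s)\<^sup>2 + (f (s + h) - f s) * (integral {0..s} f + h * f s)"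
proof -
  let ?I = "integral {0..s} f" and ?Q = "integral {0..s} (\<lambda>u. (f u)\<^sup>2)"
  let ?J = "integral {0..h} (\<lambda>u. f (s + u))" and ?K = "integral {0..h} (\<lambda>u. (f (s + u))\<^sup>2)"
  have shift: "continuous_on {0..h} (\<lambda>u. f (s + u))"
    using s by (intro continuous_on_compose2[OF cont] continuous_intros) auto
  note int = integrable_continuous_real
  have split: "integral {0..s+h} g = integral {0..s} g + integral {0..h} (\<lambda>u. g (s + u))"
    if "continuous_on {0..} g" for g :: "real \<Rightarrow> real"
  proof -
    have "integral {0..s} g + integral {s..s+h} g = integral {0..s+h} g"
      using s h by (intro Henstock_Kurzweil_Integration.integral_combine int continuous_on_subset[OF that]) auto
    then show ?thesis
      using integral_shift_Icc_real[of 0 h g s] by (simp add: o_def add.commute)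
  qed
  have A: "integral {0..h} (\<lambda>u. f (s + u) - f s) = ?J - h * f s"
    using h by (subst integral_diff) (auto intro!: int shift)
  have "integral {0..h} (\<lambda>u. (f (s + u) - f s)\<^sup>2)
      = integral {0..h} (\<lambda>u. (f (s + u))\<^sup>2 - 2 * f s * f (s + u) + (f s)\<^sup>2)"
    by (intro integral_cong) (simp add: power2_eq_square algebra_simps)
  also have "\<dots> = ?K - 2 * f s * ?J + h * (f s)\<^sup>2"
    using h by (subst integral_add integral_diff integral_mult_right; 
      (intro int continuous_intros shift)?; simp?)+
  finally have B: "integral {0..h} (\<lambda>u. (f (s + u) - f s)\<^sup>2) = ?K - 2 * f s * ?J + h * (f s)\<^sup>2" .
  \<comment> \<open>The product with \<open>A\<close> contributes \<open>- f s * ?J\<close>, and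
    \<open>- 1 / 2\<close> times \<open>B\<close> contributes \<open>f s * ?J\<close>; this is the
    cancellation of the linear term.\<close>
  show ?thesis
    unfolding path_functional_def A B
    using split[OF cont] split[OF continuous_on_power[OF cont], of 2]
    by (simp add: f0 power2_eq_square algebra_simps)
qed

section \<open>Reduction of \<open>Y\<close> to coordinates, and of zeros to changes of sign\<close>

lemma Y_process_eq_sum:
  fixes W :: "real \<Rightarrow> 'w \<Rightarrow> real ^ 'd"
  assumes t: "0 \<le> t" and cont: "\<And>i. continuous_on {0..} (\<lambda>t. W t \<omega> $ i)"
    and W0: "\<And>i. W 0 \<omega> $ i = 0"
  shows "Y_process W t \<omega> = (\<Sum>i\<in>UNIV. path_functional (\<lambda>t. W t \<omega> $ i) 0 t)"
proof -
  have c: "continuous_on {0..t} (\<lambda>s. W s \<omega> $ i)" for i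
    using cont by (rule continuous_on_subset) auto
  have int: "(\<lambda>s. W s \<omega>) integrable_on {0..t}"
    using continuous_on_vec_lambda[of "{0..t}" "\<lambda>i s. W s \<omega> $ i"] c
    by (intro integrable_continuous_real) simp
  have comp: "integral {0..t} (\<lambda>s. W s \<omega>) $ i = integral {0..t} (\<lambda>s. W s \<omega> $ i)" for i
    using integral_component_eq[OF int, of "axis i 1"] by (simp add: inner_axis)
  have "integral {0..t} (\<lambda>s. (norm (W s \<omega>))\<^sup>2) = integral {0..t} (\<lambda>s. \<Sum>i\<in>UNIV. (W s \<omega> $ i)\<^sup>2)"
    by (simp add: power2_norm_eq_inner inner_vec_def flip: power2_eq_square)
  also have "\<dots> = (\<Sum>i\<in>UNIV. integral {0..t} (\<lambda>s. (W s \<omega> $ i)\<^sup>2))"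
    by (intro integral_sum integrable_continuous_real continuous_on_power c) auto
  finally show ?thesis
    unfolding Y_process_def path_functional_def
    by (simp add: inner_vec_def comp W0 sum_subtractf sum_distrib_left)
qed

lemma continuous_on_Y_process:
  fixes W :: "real \<Rightarrow> 'w \<Rightarrow> real ^ 'd"
  assumes cont: "\<And>i. continuous_on {0..} (\<lambda>t. W t \<omega> $ i)"
  shows "continuous_on {0..T} (\<lambda>t. Y_process W t \<omega>)"
proof -
  have c: "continuous_on {0..T} (\<lambda>t. W t \<omega>)"
    using continuous_on_vec_lambda[of "{0..T}" "\<lambda>i s. W s \<omega> $ i"] continuous_on_subset[OF cont]
    by simp
  show ?thesis
    unfolding Y_process_def
    by (intro continuous_intros indefinite_integral_continuous_1 integrable_continuous_real c)
qed

lemma unbounded_zeros: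
  fixes y :: "real \<Rightarrow> real"
  assumes cont: "\<And>T. continuous_on {0..T} y"
    and pos: "\<And>T. \<exists>t\<ge>T. 0 < y t" and neg: "\<And>T. \<exists>t\<ge>T. y t < 0"
  shows "\<exists>t :: nat \<Rightarrow> real. strict_mono t \<and> \<not> bdd_above (range t) \<and> (\<forall>n. 0 \<le> t n \<and> y (t n) = 0)"
proof -
  have zero: "\<exists>t\<ge>T. y t = 0" if T: "0 \<le> T" for T
  proof -
    obtain a where a: "T \<le> a" "0 < y a" using pos by blast
    obtain b where b: "a \<le> b" "y b < 0" using neg by blast
    have "continuous_on {a..b} y"
      using T a by (intro continuous_on_subset[OF cont[of b]]) auto
    then obtain x where "a \<le> x" "x \<le> b" "y x = 0"
      using IVT2'[of y b 0 a] a b by auto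
    with a have "T \<le> x" "y x = 0" by simp_all
    then show ?thesis by blast
  qed
  \<comment> \<open>Gaps of length at least 1 yield strict monotonicity and, through
    \<open>real n \<le> t n\<close>, unboundedness.\<close>
  have "\<exists>t. \<forall>n. (0 \<le> t n \<and> y (t n) = 0) \<and> t n + 1 \<le> t (Suc n)"
  proof (rule dependent_nat_choice)
    show "\<exists>x\<ge>0. y x = 0" using zero[of 0] by auto
    fix x :: real and n :: nat assume "0 \<le> x \<and> y x = 0"
    then have "0 \<le> x + 1" by simp
    from zero[OF this] obtain z where "x + 1 \<le> z" "y z = 0" by blast
    with \<open>0 \<le> x + 1\<close> show "\<exists>z. (0 \<le> z \<and> y z = 0) \<and> x + 1 \<le> z"
      by (intro exI[of _ z]) simp
  qed
  then obtain t :: "nat \<Rightarrow> real" where t: "\<And>n. 0 \<le> t n" "\<And>n. y (t n) = 0" "\<And>n. t n + 1 \<le> t (Suc n)"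
    by blast
  have "strict_mono t"
    unfolding strict_mono_Suc_iff using t(3) by (smt (verit))
  moreover have "real n \<le> t n" for n
    by (induction n) (use t(1,3) in \<open>force intro: order_trans[rotated]\<close>)+
  then have "\<not> bdd_above (range t)"
    unfolding bdd_above_def by (metis linorder_not_less order_trans rangeI reals_Archimedean2)
  ultimately show ?thesis using t(1,2) by (intro exI[of _ t]) auto
qed

subsection \<open>Gaussian estimates\<close>

context prob_space
begin

lemma normal_second_moment:
  assumes \<sigma>: "0 < \<sigma>" and D: "distributed M lborel X (normal_density 0 \<sigma>)"
  shows "has_bochner_integral M (\<lambda>\<omega>. (X \<omega>)\<^sup>2) (\<sigma>\<^sup>2)"
proof -
  have m: "(\<lambda>x::real. x\<^sup>2) \<in> borel_measurable lborel" by measurable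
  have i: "has_bochner_integral lborel (\<lambda>x. normal_density 0 \<sigma> x * x\<^sup>2) (\<sigma>\<^sup>2)"
    using normal_moment_even[OF \<sigma>, of 0 1] \<sigma> by (simp add: eval_nat_numeral)
  show ?thesis
    using i distributed_integrable[OF D m] distributed_integral[OF D m]
    by (auto simp: has_bochner_integral_iff)
qed

lemma normal_fourth_moment:
  assumes \<sigma>: "0 < \<sigma>" and D: "distributed M lborel X (normal_density 0 \<sigma>)"
  shows "has_bochner_integral M (\<lambda>\<omega>. (X \<omega>)^4) (3 * \<sigma>^4)"
proof -
  have m: "(\<lambda>x::real. x^4) \<in> borel_measurable lborel" by measurable
  have "fact (2 * 2) / ((2 / \<sigma>\<^sup>2)^2 * fact 2) = 3 * \<sigma>^4"
    using \<sigma> by (simp add: fact_numeral field_simps)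
  then have i: "has_bochner_integral lborel (\<lambda>x. normal_density 0 \<sigma> x * x^4) (3 * \<sigma>^4)"
    using normal_moment_even[OF \<sigma>, of 0 2] by simp
  show ?thesis
    using i distributed_integrable[OF D m] distributed_integral[OF D m]
    by (auto simp: has_bochner_integral_iff)
qed

text \<open>Since \<open>sqrt (2 * pi)\<close> is at least 2, the density is at most
  \<open>1 / (2 * \<sigma>)\<close>, and the interval has length \<open>2 * a\<close>.\<close>

lemma normal_small_ball_le:
  assumes \<sigma>: "0 < \<sigma>" and a: "0 \<le> a" and D: "distributed M lborel X (normal_density 0 \<sigma>)"
  shows "prob {\<omega> \<in> space M. \<bar>X \<omega>\<bar> < a} \<le> a / \<sigma>"
proof -
  have le: "normal_density 0 \<sigma> x \<le> 1 / (2 * \<sigma>)" for x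
  proof -
    have "sqrt (2 * 2) \<le> sqrt (2 * pi)"
      using pi_gt3 by (subst real_sqrt_le_iff) auto
    then have "2 * \<sigma> \<le> sqrt (2 * pi) * \<sigma>"
      using \<sigma> by (intro mult_right_mono) auto
    then have "1 / sqrt (2 * pi * \<sigma>\<^sup>2) \<le> 1 / (2 * \<sigma>)"
      using \<sigma> by (intro divide_left_mono) (auto simp: real_sqrt_mult)
    moreover have "exp (- (x - 0)\<^sup>2 / (2 * \<sigma>\<^sup>2)) \<le> 1" by simp
    ultimately have "1 / sqrt (2 * pi * \<sigma>\<^sup>2) * exp (- (x - 0)\<^sup>2 / (2 * \<sigma>\<^sup>2)) \<le> 1 / (2 * \<sigma>) * 1"
      using \<sigma> by (intro mult_mono) auto
    then show ?thesis by (simp add: normal_density_def)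
  qed
  have "emeasure M {\<omega> \<in> space M. \<bar>X \<omega>\<bar> < a} = emeasure M (X -` {-a<..<a} \<inter> space M)"
    by (intro arg_cong[where f="emeasure M"]) auto
  also have "\<dots> = (\<integral>\<^sup>+x. ennreal (normal_density 0 \<sigma> x) * indicator {-a<..<a} x \<partial>lborel)"
    by (rule distributed_emeasure[OF D]) simp
  also have "\<dots> \<le> (\<integral>\<^sup>+x. ennreal (1 / (2 * \<sigma>)) * indicator {-a<..<a} x \<partial>lborel)"
    by (intro nn_integral_mono mult_right_mono ennreal_leI le) simp
  also have "\<dots> = ennreal (a / \<sigma>)"
    using a \<sigma> by (subst nn_integral_cmult) (simp_all add: ennreal_mult[symmetric])
  finally show ?thesis
    using a \<sigma> by (simp add: emeasure_eq_measure)
qed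

text \<open>The centred density decreases in the distance from 0, which is at most \<open>K\<close>
  on the interval in question. The bound depends on the shift \<open>x\<close> only through
  \<open>K\<close>, as conditioning on \<open>x\<close> will require.\<close>

lemma normal_interval_ge:
  assumes \<sigma>: "0 < \<sigma>" and a: "0 \<le> a" and K: "\<bar>x\<bar> + a \<le> K"
    and D: "distributed M lborel X (normal_density 0 \<sigma>)"
  shows "2 * a * normal_density 0 \<sigma> K \<le> prob {\<omega> \<in> space M. \<bar>x + X \<omega>\<bar> \<le> a}"
proof -
  have ge: "normal_density 0 \<sigma> K \<le> normal_density 0 \<sigma> y" if "y \<in> {-x-a..-x+a}" for y
  proof -
    have "\<bar>y\<bar> \<le> \<bar>K\<bar>" using that K by auto
    then have "y\<^sup>2 \<le> K\<^sup>2" by (simp add: abs_le_square_iff)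
    then have "- K\<^sup>2 / (2 * \<sigma>\<^sup>2) \<le> - y\<^sup>2 / (2 * \<sigma>\<^sup>2)"
      using \<sigma> by (intro divide_right_mono) auto
    then show ?thesis
      unfolding normal_density_def by (intro mult_left_mono) auto
  qed
  have "ennreal (2 * a * normal_density 0 \<sigma> K)
      = (\<integral>\<^sup>+y. ennreal (normal_density 0 \<sigma> K) * indicator {-x-a..-x+a} y \<partial>lborel)"
    using a by (simp add: nn_integral_cmult ennreal_mult[symmetric] mult.commute)
  also have "\<dots> \<le> (\<integral>\<^sup>+y. ennreal (normal_density 0 \<sigma> y) * indicator {-x-a..-x+a} y \<partial>lborel)"
    by (intro nn_integral_mono) (auto simp: indicator_def intro!: ennreal_leI ge)
  also have "\<dots> = emeasure M (X -` {-x-a..-x+a} \<inter> space M)"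
    by (rule distributed_emeasure[OF D, symmetric]) simp
  also have "X -` {-x-a..-x+a} \<inter> space M = {\<omega> \<in> space M. \<bar>x + X \<omega>\<bar> \<le> a}"
    by auto
  finally show ?thesis
    by (simp add: emeasure_eq_measure)
qed

text \<open>A form of conditioning on \<open>X\<close> that avoids conditional probabilities: by
  independence the joint law is a product, and Fubini integrates the section probabilities, each at
  least \<open>c\<close>, over \<open>G\<close>.\<close>

lemma indep_var_section_ge:
  assumes ind: "indep_var S X T Y" and G: "G \<in> sets S"
    and E[measurable]: "Measurable.pred (S \<Otimes>\<^sub>M T) (\<lambda>(x, y). \<phi> x y)"
    and c: "0 \<le> c" "\<And>x. x \<in> G \<Longrightarrow> c \<le> prob {\<omega> \<in> space M. \<phi> x (Y \<omega>)}"
  shows "c * prob {\<omega> \<in> space M. X \<omega> \<in> G} \<le> prob {\<omega> \<in> space M. X \<omega> \<in> G \<and> \<phi> (X \<omega>) (Y \<omega>)}"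
proof -
  have X[measurable]: "X \<in> measurable M S" and Y[measurable]: "Y \<in> measurable M T"
    and d: "distr M S X \<Otimes>\<^sub>M distr M T Y = distr M (S \<Otimes>\<^sub>M T) (\<lambda>\<omega>. (X \<omega>, Y \<omega>))"
    using ind unfolding indep_var_distribution_eq by auto
  interpret Y: prob_space "distr M T Y" by (rule prob_space_distr) fact
  note G[measurable]
  let ?E = "{z \<in> space (S \<Otimes>\<^sub>M T). fst z \<in> G \<and> \<phi> (fst z) (snd z)}"
  have E': "?E \<in> sets (S \<Otimes>\<^sub>M T)"
    using E by (simp add: case_prod_beta')
  have sec: "c \<le> measure (distr M T Y) (Pair x -` ?E)" if x: "x \<in> G" for x
  proof -
    have xS: "x \<in> space S" using x G sets.sets_into_space by blast
    have "Pair x -` ?E \<in> sets T"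
      using sets_Pair1[OF E'] by simp
    then have "measure (distr M T Y) (Pair x -` ?E) = prob (Y -` (Pair x -` ?E) \<inter> space M)"
      by (simp add: measure_distr)
    also have "Y -` (Pair x -` ?E) \<inter> space M = {\<omega> \<in> space M. \<phi> x (Y \<omega>)}"
      using x xS measurable_space[OF Y] by (auto simp: space_pair_measure)
    finally show ?thesis using c(2)[OF x] by simp
  qed
  have "ennreal (c * prob {\<omega> \<in> space M. X \<omega> \<in> G}) = ennreal c * emeasure (distr M S X) G"
    using G c(1) by (simp add: emeasure_distr emeasure_eq_measure ennreal_mult vimage_def Int_def conj_commute)
  also have "\<dots> = (\<integral>\<^sup>+x. ennreal c * indicator G x \<partial>distr M S X)"
    using G by (subst nn_integral_cmult) auto
  also have "\<dots> \<le> (\<integral>\<^sup>+x. emeasure (distr M T Y) (Pair x -` ?E) \<partial>distr M S X)"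
  proof (intro nn_integral_mono)
    fix x
    show "ennreal c * indicator G x \<le> emeasure (distr M T Y) (Pair x -` ?E)"
    proof (cases "x \<in> G")
      case True
      then show ?thesis
        using ennreal_leI[OF sec[OF True]] by (simp only: Y.emeasure_eq_measure indicator_simps mult_1_right)
    qed simp
  qed
  also have "\<dots> = emeasure (distr M S X \<Otimes>\<^sub>M distr M T Y) ?E"
    using E' by (subst Y.emeasure_pair_measure_alt) (simp_all cong: sets_pair_measure_cong)
  also have "\<dots> = emeasure M ((\<lambda>\<omega>. (X \<omega>, Y \<omega>)) -` ?E \<inter> space M)"
    unfolding d using E' by (subst emeasure_distr) auto
  also have "(\<lambda>\<omega>. (X \<omega>, Y \<omega>)) -` ?E \<inter> space M = {\<omega> \<in> space M. X \<omega> \<in> G \<and> \<phi> (X \<omega>) (Y \<omega>)}"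
    using measurable_space[OF X] measurable_space[OF Y] by (auto simp: space_pair_measure)
  finally show ?thesis
    by (simp add: emeasure_eq_measure)
qed

end

subsection \<open>Gaussian random walks\<close>

text \<open>
  In this form the functional is large only if the endpoint is, and negative if the endpoint is small
  compared with the deviations from it.
\<close>

lemma walk_functional_alt:
  "walk_functional S m = (\<Sum>k=1..m. (S m)\<^sup>2 - (S m - S k)\<^sup>2) / (2 * real m)"
proof -
  have "(\<Sum>k=1..m. (S m)\<^sup>2 - (S m - S k)\<^sup>2) = (\<Sum>k=1..m. 2 * S m * S k - (S k)\<^sup>2)"
    by (intro sum.cong) (auto simp: power2_eq_square algebra_simps)
  also have "\<dots> = 2 * S m * (\<Sum>k=1..m. S k) - (\<Sum>k=1..m. (S k)\<^sup>2)"
    by (simp add: sum_subtractf sum_distrib_left)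
  finally show ?thesis
    by (cases "m = 0") (simp_all add: walk_functional_def field_simps)
qed

lemma walk_functional_le:
  "walk_functional S m \<le> (S m)\<^sup>2 / 2"
proof -
  have "(\<Sum>k=1..m. (S m)\<^sup>2 - (S m - S k)\<^sup>2) \<le> (\<Sum>k=1..m. (S m)\<^sup>2)"
    by (intro sum_mono) simp
  then show ?thesis
    unfolding walk_functional_alt by (cases "m = 0") (auto simp: field_simps)
qed

text \<open>Cauchy-Schwarz replaces a sum of squares by the square of a linear, hence Gaussian,
  quantity. Only the deviations with \<open>k \<ge> n\<close> are kept: they involve steps of the
  second half alone, so the first half remains free to steer the endpoint.\<close>

lemma walk_functional_le_half:
  assumes M: "0 < n"
  shows "walk_functional S (2 * n)
    \<le> (S (2 * n))\<^sup>2 / 2 - ((\<Sum>k=n..<2*n. S (2 * n) - S k) / real n)\<^sup>2 / 4"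
proof -
  let ?d = "\<lambda>k. S (2 * n) - S k"
  have "(\<Sum>k=n..<2*n. ?d k)\<^sup>2 \<le> (\<Sum>k=n..<2*n. (?d k)\<^sup>2) * (\<Sum>k=n..<2*n. 1\<^sup>2)"
    using Cauchy_Schwarz_ineq_sum[of ?d "\<lambda>_. 1" "{n..<2*n}"] by simp
  also have "\<dots> = (\<Sum>k=n..<2*n. (?d k)\<^sup>2) * real n"
    by simp
  also have "\<dots> \<le> (\<Sum>k=1..2*n. (?d k)\<^sup>2) * real n"
    using M by (intro mult_right_mono sum_mono2) auto
  finally have "((\<Sum>k=n..<2*n. ?d k) / real n)\<^sup>2 / 4 \<le> (\<Sum>k=1..2*n. (?d k)\<^sup>2) / (4 * real n)"
    using M by (simp add: power_divide field_simps power2_eq_square)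
  moreover have "walk_functional S (2 * n) = (S (2 * n))\<^sup>2 / 2 - (\<Sum>k=1..2*n. (?d k)\<^sup>2) / (4 * real n)"
    unfolding walk_functional_alt using M by (simp add: sum_subtractf field_simps)
  ultimately show ?thesis by simp
qed

context prob_space
begin

lemma normal_walk_increment:
  assumes ind: "indep_vars (\<lambda>_. borel) X {..<m}" and \<sigma>: "0 < \<sigma>"
    and D: "\<And>j. j < m \<Longrightarrow> distributed M lborel (X j) (normal_density 0 \<sigma>)"
    and jk: "j < k" "k \<le> m"
  shows "distributed M lborel (\<lambda>\<omega>. \<Sum>i=j..<k. X i \<omega>) (normal_density 0 (\<sigma> * sqrt (real (k - j))))"
proof -
  have "distributed M lborel (\<lambda>\<omega>. \<Sum>i=j..<k. X i \<omega>)
      (normal_density (\<Sum>i=j..<k. 0) (sqrt (\<Sum>i=j..<k. \<sigma>\<^sup>2)))"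
    using jk \<sigma> by (intro sum_indep_normal indep_vars_subset[OF ind] D) auto
  then show ?thesis
    using \<sigma> by (simp add: real_sqrt_mult mult.commute)
qed

text \<open>A moment argument of Paley-Zygmund type. The mean is at least \<open>h / 4\<close>,
  where \<open>h\<close> is the variance of the endpoint, while the functional is at most half the
  squared endpoint, whose second moment is \<open>3 * h\<^sup>2\<close>. So values above
  \<open>h / 8\<close> must carry a fixed share of the probability.\<close>

lemma walk_functional_positive:
  assumes ind: "indep_vars (\<lambda>_. borel) X {..<m}" and m: "0 < m" and \<sigma>: "0 < \<sigma>"
    and D: "\<And>j. j < m \<Longrightarrow> distributed M lborel (X j) (normal_density 0 \<sigma>)"
  shows "1 / 48 \<le> prob {\<omega> \<in> space M. real m * \<sigma>\<^sup>2 / 8 \<le> walk_functional (\<lambda>k. \<Sum>j<k. X j \<omega>) m}"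
proof -
  define S where "S k \<omega> = (\<Sum>j<k. X j \<omega>)" for k \<omega>
  define Q where "Q \<omega> = walk_functional (\<lambda>k. S k \<omega>) m" for \<omega>
  define h where "h = real m * \<sigma>\<^sup>2"
  have h: "0 < h" using m \<sigma> by (simp add: h_def)
  define A where "A = {\<omega> \<in> space M. h / 8 \<le> Q \<omega>}"
  have X[measurable]: "X j \<in> borel_measurable M" if "j < m" for j
    using ind that by (auto simp: indep_vars_def)
  have S[measurable]: "S k \<in> borel_measurable M" if "k \<le> m" for k
    unfolding S_def using that by (intro borel_measurable_sum X) auto
  have Q_alt: "Q \<omega> = (\<Sum>k=1..m. (S m \<omega>)\<^sup>2 - (S m \<omega> - S k \<omega>)\<^sup>2) / (2 * real m)" for \<omega>
    unfolding Q_def walk_functional_alt ..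
  have [measurable]: "Q \<in> borel_measurable M"
    unfolding Q_alt[abs_def]
    by (intro borel_measurable_divide borel_measurable_sum borel_measurable_diff
        borel_measurable_power S borel_measurable_const) auto
  have [measurable]: "A \<in> sets M" unfolding A_def by measurable
  have diff: "S m \<omega> - S k \<omega> = (\<Sum>i=k..<m. X i \<omega>)" if "k \<le> m" for k \<omega>
    using sum_diff_nat_ivl[of 0 k m "\<lambda>i. X i \<omega>"] that by (simp add: S_def lessThan_atLeast0)
  have Sm: "distributed M lborel (S m) (normal_density 0 (\<sigma> * sqrt (real m)))"
    using normal_walk_increment[OF ind \<sigma> D, of 0 m] m by (simp add: S_def[abs_def] lessThan_atLeast0)
  have pos: "0 < \<sigma> * sqrt (real m)" using \<sigma> m by simp
  have m2: "has_bochner_integral M (\<lambda>\<omega>. (S m \<omega>)\<^sup>2) h"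
    using normal_second_moment[OF pos Sm] by (simp add: h_def power_mult_distrib mult.commute)
  have "(\<sigma> * sqrt (real m)) ^ 4 = ((\<sigma> * sqrt (real m))\<^sup>2)\<^sup>2"
    by (simp only: power_mult[symmetric]) simp
  also have "(\<sigma> * sqrt (real m))\<^sup>2 = h"
    by (simp add: h_def power_mult_distrib)
  finally have m4: "has_bochner_integral M (\<lambda>\<omega>. (S m \<omega>)^4) (3 * h\<^sup>2)"
    using normal_fourth_moment[OF pos Sm] by simp
  have md: "has_bochner_integral M (\<lambda>\<omega>. (S m \<omega> - S k \<omega>)\<^sup>2) (real (m - k) * \<sigma>\<^sup>2)" if k: "k \<le> m" for k
  proof (cases "k = m")
    case False
    with k have km: "k < m" by simp
    then have "0 < \<sigma> * sqrt (real (m - k))" using \<sigma> by simp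
    from normal_second_moment[OF this normal_walk_increment[OF ind \<sigma> D km order_refl]]
    show ?thesis
      by (simp add: diff[OF k] power_mult_distrib mult.commute)
  qed (simp add: has_bochner_integral_zero)
  have "has_bochner_integral M Q ((\<Sum>k=1..m. h - real (m - k) * \<sigma>\<^sup>2) / (2 * real m))"
    unfolding Q_alt[abs_def]
    by (intro has_bochner_integral_divide_zero has_bochner_integral_sum has_bochner_integral_diff m2 md) auto
  moreover have "(\<Sum>k=1..m. h - real (m - k) * \<sigma>\<^sup>2) = \<sigma>\<^sup>2 * (\<Sum>k=1..m. real k)"
    unfolding h_def sum_distrib_left
    by (intro sum.cong) (auto simp: of_nat_diff algebra_simps)
  moreover have "(\<Sum>k=1..m. real k) = real m * (real m + 1) / 2"
    using double_gauss_sum_from_Suc_0[of m, where ?'a=real] by simp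
  moreover have "\<sigma>\<^sup>2 * (real m * (real m + 1) / 2) / (2 * real m) = \<sigma>\<^sup>2 * (real m + 1) / 4"
    using m by (simp add: field_simps)
  ultimately have mQ: "has_bochner_integral M Q (\<sigma>\<^sup>2 * (real m + 1) / 4)"
    by metis
  have bound: "Q \<omega> \<le> h / 8 + ((S m \<omega>)^4 / (24 * h) + 6 * h * indicator A \<omega>) / 2" if "\<omega> \<in> space M" for \<omega>
  proof (cases "\<omega> \<in> A")
    case True
    \<comment> \<open>The weight \<open>12 * h\<close> makes the fourth-moment term contribute only
      \<open>h / 16\<close> to the final mean, which together with \<open>h / 8\<close> stays below
      \<open>h / 4\<close>.\<close>
    have "0 \<le> ((S m \<omega>)\<^sup>2 - 12 * h)\<^sup>2" by simp
    then have "2 * (12 * h) * (S m \<omega>)\<^sup>2 \<le> (S m \<omega>)^4 + (12 * h)\<^sup>2"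
      by (simp add: power2_diff power_mult[symmetric] algebra_simps)
    then have *: "(S m \<omega>)\<^sup>2 \<le> (S m \<omega>)^4 / (24 * h) + 6 * h"
      using h by (simp add: field_simps power2_eq_square)
    have "Q \<omega> \<le> (S m \<omega>)\<^sup>2 / 2" unfolding Q_def by (rule walk_functional_le)
    also have "\<dots> \<le> ((S m \<omega>)^4 / (24 * h) + 6 * h) / 2"
      using * by (rule divide_right_mono) simp
    finally have "Q \<omega> \<le> ((S m \<omega>)^4 / (24 * h) + 6 * h) / 2" .
    then show ?thesis using True h by (intro add_increasing) auto
  next
    case False
    with that have "Q \<omega> \<le> h / 8" by (auto simp: A_def)
    then show ?thesis using False h by (simp add: add_increasing2)
  qed
  have mR: "has_bochner_integral M (\<lambda>\<omega>. h / 8 + ((S m \<omega>)^4 / (24 * h) + 6 * h * indicator A \<omega>) / 2)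
      (h / 8 + (3 * h\<^sup>2 / (24 * h) + 6 * h * prob A) / 2)"
    using has_bochner_integral_real_indicator[of A M]
    by (intro has_bochner_integral_add has_bochner_integral_divide_zero has_bochner_integral_mult_right m4)
       (auto simp: has_bochner_integral_iff prob_space emeasure_eq_measure)
  have "h * (1 / 4) \<le> \<sigma>\<^sup>2 * (real m + 1) / 4"
    by (simp add: h_def algebra_simps)
  also have "\<dots> \<le> h / 8 + (3 * h\<^sup>2 / (24 * h) + 6 * h * prob A) / 2"
    using integral_mono[OF integrable.intros[OF mQ] integrable.intros[OF mR] bound]
    unfolding has_bochner_integral_integral_eq[OF mQ] has_bochner_integral_integral_eq[OF mR] .
  also have "\<dots> = h * (3 / 16 + 3 * prob A)"
    using h by (simp add: field_simps power2_eq_square)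
  finally have "h * (1 / 4) \<le> h * (3 / 16 + 3 * prob A)" .
  then have "1 / 4 \<le> 3 / 16 + 3 * prob A"
    using h by (simp only: mult_le_cancel_left_pos)
  then have "1 / 48 \<le> prob A" by simp
  then show ?thesis by (simp add: A_def Q_def h_def S_def)
qed


text \<open>The steps of the second half make the mean deviation from the endpoint large with
  probability at least 1/4; given them, the independent first half brings the endpoint close to 0
  with probability bounded below.\<close>

lemma walk_functional_negative:
  assumes n: "0 < n" and ind: "indep_vars (\<lambda>_. borel) X {..<2*n}" and \<sigma>: "0 < \<sigma>"
    and D: "\<And>j. j < 2 * n \<Longrightarrow> distributed M lborel (X j) (normal_density 0 \<sigma>)"
  shows "exp (-4) / (40 * sqrt pi)
    \<le> prob {\<omega> \<in> space M. walk_functional (\<lambda>k. \<Sum>j<k. X j \<omega>) (2 * n) \<le> - (real (2 * n) * \<sigma>\<^sup>2 / 800)}"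
proof -
  \<comment> \<open>\<open>r\<close> is the standard deviation of the endpoint, and each half of the
    walk has variance \<open>r\<^sup>2 / 2\<close>.\<close>
  define r where "r = \<sigma> * sqrt (real (2 * n))"
  have r: "0 < r" and r2: "r\<^sup>2 = real (2 * n) * \<sigma>\<^sup>2" and r2': "\<sigma> * sqrt (real n) = sqrt (r\<^sup>2 / 2)"
    using n \<sigma> by (simp_all add: r_def power_mult_distrib real_sqrt_mult)
  define \<tau> where "\<tau> = sqrt (\<Sum>j=n..<2*n. (real (Suc j - n) / real n * \<sigma>)\<^sup>2)"
  let ?I = "{n..<2*n}"
  let ?N = "PiM ?I (\<lambda>_. borel :: real measure)"
  \<comment> \<open>\<open>A\<close> is the mean of \<open>S (2 * n) - S k\<close> over
    \<open>n \<le> k < 2 * n\<close>: step \<open>j\<close> occurs in the terms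
    \<open>k = n, ..., j\<close>, that is \<open>Suc j - n\<close> times. Its standard deviation is
    \<open>\<tau>\<close>.\<close>
  define A where "A x = (\<Sum>j\<in>?I. real (Suc j - n) / real n * x j)" for x :: "nat \<Rightarrow> real"
  define T where "T x = (\<Sum>j\<in>?I. x j)" for x :: "nat \<Rightarrow> real"
  have [measurable]: "A \<in> borel_measurable ?N" "T \<in> borel_measurable ?N"
    unfolding A_def[abs_def] T_def[abs_def] by measurable
  let ?U = "\<lambda>\<omega>. restrict (\<lambda>j. X j \<omega>) ?I"
  let ?V = "\<lambda>\<omega>. \<Sum>j<n. X j \<omega>"
  have Uin: "?U \<omega> \<in> space ?N" for \<omega> by (auto simp: space_PiM)
  have X[measurable]: "X j \<in> borel_measurable M" if "j < 2 * n" for j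
    using ind that by (auto simp: indep_vars_def)
  have U[measurable]: "?U \<in> measurable M ?N"
    by (intro measurable_restrict X) auto
  have ivar: "indep_var ?N ?U (PiM {..<n} (\<lambda>_. borel)) (\<lambda>\<omega>. restrict (\<lambda>j. X j \<omega>) {..<n})"
    by (intro indep_var_restrict[OF ind]) auto
  have AU: "distributed M lborel (\<lambda>\<omega>. A (?U \<omega>)) (normal_density 0 \<tau>)"
  proof -
    have "indep_vars (\<lambda>_. borel) (\<lambda>j \<omega>. real (Suc j - n) / real n * X j \<omega>) ?I"
      by (intro indep_vars_compose2[OF indep_vars_subset[OF ind]]) auto
    moreover have "distributed M lborel (\<lambda>\<omega>. real (Suc j - n) / real n * X j \<omega>)
        (normal_density 0 (real (Suc j - n) / real n * \<sigma>))" if "j \<in> ?I" for j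
      using normal_density_affine[OF D \<sigma>, of j "real (Suc j - n) / real n" 0] that n by simp
    ultimately have "distributed M lborel (\<lambda>\<omega>. \<Sum>j\<in>?I. real (Suc j - n) / real n * X j \<omega>)
        (normal_density (\<Sum>j\<in>?I. 0) \<tau>)"
      unfolding \<tau>_def using n \<sigma> by (intro sum_indep_normal) auto
    then show ?thesis by (simp add: A_def)
  qed
  have TU: "distributed M lborel (\<lambda>\<omega>. T (?U \<omega>)) (normal_density 0 (sqrt (r\<^sup>2 / 2)))"
    using normal_walk_increment[OF ind \<sigma> D, of n "2 * n"] n by (simp add: T_def flip: r2')
  have VD: "distributed M lborel ?V (normal_density 0 (sqrt (r\<^sup>2 / 2)))"
    using normal_walk_increment[OF ind \<sigma> D, of 0 n] n by (simp add: lessThan_atLeast0 flip: r2')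
  have s0: "0 < sqrt (r\<^sup>2 / 2)" using r by simp
  \<comment> \<open>The squares of \<open>1, ..., n\<close> sum to at least \<open>n^3 / 3\<close>,
    so the variance of \<open>A\<close> is at least \<open>r\<^sup>2 / 6\<close>, and 4/25 is below
    1/6.\<close>
  have \<tau>: "r * (2 / 5) \<le> \<tau>"
  proof -
    have "(\<Sum>j=n..<2*n. (real (Suc j - n))\<^sup>2) = (\<Sum>i=1..n. (real i)\<^sup>2)"
      by (rule sum.reindex_bij_witness[of _ "\<lambda>i. i + n - 1" "\<lambda>j. Suc j - n"]) auto
    moreover have "(real k) ^ 3 / 3 \<le> (\<Sum>i=1..k. (real i)\<^sup>2)" for k
      by (induction k) (auto simp: power2_eq_square power3_eq_cube algebra_simps)
    ultimately have "(real n) ^ 3 / 3 * (\<sigma> / real n)\<^sup>2 \<le> (\<Sum>j=n..<2*n. (real (Suc j - n))\<^sup>2) * (\<sigma> / real n)\<^sup>2"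
      by (intro mult_right_mono) auto
    also have "(\<Sum>j=n..<2*n. (real (Suc j - n))\<^sup>2) * (\<sigma> / real n)\<^sup>2
        = (\<Sum>j=n..<2*n. (real (Suc j - n) / real n * \<sigma>)\<^sup>2)"
      unfolding sum_distrib_right by (intro sum.cong) (auto simp: power_mult_distrib power_divide)
    also have "(real n) ^ 3 / 3 * (\<sigma> / real n)\<^sup>2 = r\<^sup>2 / 6"
      unfolding r2 using n by (simp add: power_divide power2_eq_square power3_eq_cube)
    finally have "r\<^sup>2 / 6 \<le> (\<Sum>j=n..<2*n. (real (Suc j - n) / real n * \<sigma>)\<^sup>2)" .
    moreover have "(r * (2 / 5))\<^sup>2 \<le> r\<^sup>2 / 6"
      using zero_le_power2[of r] by (simp add: power_mult_distrib power_divide)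
    ultimately have "(r * (2 / 5))\<^sup>2 \<le> (\<Sum>j=n..<2*n. (real (Suc j - n) / real n * \<sigma>)\<^sup>2)"
      by (rule order_trans[rotated])
    then show ?thesis unfolding \<tau>_def by (rule real_le_rsqrt)
  qed
  then have \<tau>0: "0 < \<tau>" using r by (smt (verit) mult_pos_pos divide_pos_pos)
  \<comment> \<open>The small-ball bound costs at most 1/4 for \<open>A\<close> and Chebyshev at
    most 1/2 for \<open>T\<close>, which leaves probability 1/4 for \<open>G\<close>.\<close>
  define G where "G = {x \<in> space ?N. r / 10 \<le> \<bar>A x\<bar> \<and> \<bar>T x\<bar> < r}"
  have G: "G \<in> sets ?N" unfolding G_def by measurable
  have "1 / 4 \<le> prob {\<omega> \<in> space M. ?U \<omega> \<in> G}"
  proof -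
    let ?A = "{\<omega> \<in> space M. \<bar>A (?U \<omega>)\<bar> < r / 10}" and ?T = "{\<omega> \<in> space M. r \<le> \<bar>T (?U \<omega>)\<bar>}"
    have "prob ?A \<le> (r / 10) / \<tau>"
      using r by (intro normal_small_ball_le \<tau>0 AU) auto
    also have "\<dots> \<le> 1 / 4"
      using \<tau> \<tau>0 by (simp add: field_simps)
    finally have 1: "prob ?A \<le> 1 / 4" .
    have T2: "has_bochner_integral M (\<lambda>\<omega>. (T (?U \<omega>))\<^sup>2) (r\<^sup>2 / 2)"
      using normal_second_moment[OF s0 TU] r by simp
    have "prob ?T \<le> r\<^sup>2 / 2 / r\<^sup>2"
      using second_moment_method[OF _ integrable.intros[OF T2] r]
      unfolding has_bochner_integral_integral_eq[OF T2] by simp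
    then have 2: "prob ?T \<le> 1 / 2" using r by simp
    have "prob (space M - {\<omega> \<in> space M. ?U \<omega> \<in> G}) \<le> prob (?A \<union> ?T)"
      using Uin by (intro finite_measure_mono) (auto simp: G_def)
    also have "\<dots> \<le> prob ?A + prob ?T"
      by (intro measure_Un_le) measurable
    finally show ?thesis
      using 1 2 G by (subst (asm) prob_compl) auto
  qed
  then have "exp (-4) / (10 * sqrt pi) * (1 / 4) \<le> exp (-4) / (10 * sqrt pi) * prob {\<omega> \<in> space M. ?U \<omega> \<in> G}"
    by (intro mult_left_mono) auto
  also have "exp (-4) / (10 * sqrt pi) * prob {\<omega> \<in> space M. ?U \<omega> \<in> G}
      \<le> prob {\<omega> \<in> space M. ?U \<omega> \<in> G \<and> \<bar>T (?U \<omega>) + (\<Sum>j<n. restrict (\<lambda>j. X j \<omega>) {..<n} j)\<bar> \<le> r / 20}"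
  proof (rule indep_var_section_ge[OF ivar G, where \<phi> = "\<lambda>x y. \<bar>T x + (\<Sum>j<n. y j)\<bar> \<le> r / 20"])
    show "Measurable.pred (?N \<Otimes>\<^sub>M PiM {..<n} (\<lambda>_. borel)) (\<lambda>(x, y). \<bar>T x + (\<Sum>j<n. y j)\<bar> \<le> r / 20)"
      by measurable
    fix x assume "x \<in> G"
    \<comment> \<open>At \<open>2 * r\<close> the density with variance \<open>r\<^sup>2 / 2\<close>
      is \<open>exp (-4) / (r * sqrt pi)\<close>; multiplied by the interval length
      \<open>r / 10\<close> it gives the constant of the section bound.\<close>
    then have "\<bar>T x\<bar> + r / 20 \<le> 2 * r" using r by (auto simp: G_def)
    then have "2 * (r / 20) * normal_density 0 (sqrt (r\<^sup>2 / 2)) (2 * r)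
        \<le> prob {\<omega> \<in> space M. \<bar>T x + ?V \<omega>\<bar> \<le> r / 20}"
      using r by (intro normal_interval_ge s0 VD) auto
    then show "exp (-4) / (10 * sqrt pi)
        \<le> prob {\<omega> \<in> space M. \<bar>T x + (\<Sum>j<n. restrict (\<lambda>j. X j \<omega>) {..<n} j)\<bar> \<le> r / 20}"
      using r by (simp add: normal_density_def real_sqrt_mult power_mult_distrib)
  qed simp
  also have "prob {\<omega> \<in> space M. ?U \<omega> \<in> G \<and> \<bar>T (?U \<omega>) + (\<Sum>j<n. restrict (\<lambda>j. X j \<omega>) {..<n} j)\<bar> \<le> r / 20}
      = prob {\<omega> \<in> space M. ?U \<omega> \<in> G \<and> \<bar>T (?U \<omega>) + ?V \<omega>\<bar> \<le> r / 20}"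
    by simp
  also have "\<dots> \<le> prob {\<omega> \<in> space M. walk_functional (\<lambda>k. \<Sum>j<k. X j \<omega>) (2 * n) \<le> - (real (2 * n) * \<sigma>\<^sup>2 / 800)}"
  proof (intro finite_measure_mono subsetI)
    fix \<omega>
    assume \<omega>: "\<omega> \<in> {\<omega> \<in> space M. ?U \<omega> \<in> G \<and> \<bar>T (?U \<omega>) + ?V \<omega>\<bar> \<le> r / 20}"
    let ?S = "\<lambda>k. \<Sum>j<k. X j \<omega>"
    have dif: "?S (2 * n) - ?S k = (\<Sum>j=k..<2*n. X j \<omega>)" if "k \<le> 2 * n" for k
      using sum_diff_nat_ivl[of 0 k "2 * n" "\<lambda>j. X j \<omega>"] that by (simp add: lessThan_atLeast0)
    have "(\<Sum>k=n..<2*n. ?S (2 * n) - ?S k) = (\<Sum>k=n..<2*n. \<Sum>j=k..<2*n. X j \<omega>)"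
      by (intro sum.cong dif) auto
    also have "\<dots> = (\<Sum>j=n..<2*n. \<Sum>k=n..j. X j \<omega>)"
      by (subst sum.Sigma, simp, simp, subst sum.Sigma, simp, simp,
          rule sum.reindex_bij_witness[of _ "\<lambda>(j, k). (k, j)" "\<lambda>(k, j). (j, k)"]) auto
    also have "\<dots> = real n * A (?U \<omega>)"
      using n unfolding A_def sum_distrib_left by (intro sum.cong) auto
    finally have "walk_functional ?S (2 * n) \<le> (?S (2 * n))\<^sup>2 / 2 - (A (?U \<omega>))\<^sup>2 / 4"
      using walk_functional_le_half[OF n, of ?S] n by simp
    moreover have "?S (2 * n) = T (?U \<omega>) + ?V \<omega>"
      using dif[of n] by (simp add: T_def)
    then have "(?S (2 * n))\<^sup>2 \<le> (r / 20)\<^sup>2"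
      using \<omega> r by (simp add: abs_le_square_iff[symmetric])
    moreover have "(r / 10)\<^sup>2 \<le> (A (?U \<omega>))\<^sup>2"
      using \<omega> r by (simp add: abs_le_square_iff[symmetric] G_def)
    \<comment> \<open>The endpoint contributes at most \<open>r\<^sup>2 / 800\<close> and the
      deviations subtract at least \<open>r\<^sup>2 / 400\<close>.\<close>
    ultimately have "walk_functional ?S (2 * n) \<le> - (r\<^sup>2 / 800)"
      by (simp add: power_divide)
    then show "\<omega> \<in> {\<omega> \<in> space M. walk_functional (\<lambda>k. \<Sum>j<k. X j \<omega>) (2 * n) \<le> - (real (2 * n) * \<sigma>\<^sup>2 / 800)}"
      using \<omega> by (simp add: r2)
  next
    have "(\<lambda>\<omega>. walk_functional (\<lambda>k. \<Sum>j<k. X j \<omega>) (2 * n)) \<in> borel_measurable M"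
      unfolding walk_functional_def
      by (intro borel_measurable_divide borel_measurable_sum borel_measurable_diff borel_measurable_times
          borel_measurable_power X borel_measurable_const) auto
    then show "{\<omega> \<in> space M. walk_functional (\<lambda>k. \<Sum>j<k. X j \<omega>) (2 * n) \<le> - (real (2 * n) * \<sigma>\<^sup>2 / 800)} \<in> events"
      by measurable
  qed
  finally show ?thesis by simp
qed

end

subsection \<open>Blocks of increments of a Wiener process\<close>

lemma sampled_functional_restrict:
  assumes "0 \<le> s" "0 \<le> h"
  shows "sampled_functional (restrict f {0..}) s h m = sampled_functional f s h m"
  using assms by (simp add: sampled_functional_def walk_functional_def)

lemma sampled_functional_measurable:
  assumes "\<And>t. 0 \<le> t \<Longrightarrow> (\<lambda>x. g x t) \<in> borel_measurable N" "0 \<le> s" "0 \<le> h"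
  shows "(\<lambda>x. sampled_functional (g x) s h m) \<in> borel_measurable N"
  unfolding sampled_functional_def walk_functional_def
  using assms
  by (intro borel_measurable_times borel_measurable_diff borel_measurable_divide borel_measurable_sum
      borel_measurable_power borel_measurable_const assms(1)) auto

section \<open>Convergence in probability and the zero-one law\<close>

context prob_space
begin

text \<open>Almost sure convergence implies convergence in probability: the tail unions decrease to
  a null set, so continuity from above applies.\<close>

lemma AE_tendsto_0_imp_prob_less:
  fixes f :: "nat \<Rightarrow> 'a \<Rightarrow> real"
  assumes f[measurable]: "\<And>n. f n \<in> borel_measurable M"
    and lim: "AE \<omega> in M. (\<lambda>n. f n \<omega>) \<longlonglongrightarrow> 0" and e: "0 < e" and d: "0 < d"
  obtains n where "prob {\<omega> \<in> space M. e \<le> \<bar>f n \<omega>\<bar>} < d"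
proof -
  let ?A = "\<lambda>n. {\<omega> \<in> space M. e \<le> \<bar>f n \<omega>\<bar>}"
  let ?B = "\<lambda>n. \<Union>m\<in>{n..}. ?A m"
  have "(\<lambda>n. prob (?B n)) \<longlonglongrightarrow> prob (\<Inter>n. ?B n)"
  proof (intro finite_Lim_measure_decseq)
    show "decseq ?B" unfolding decseq_def by (intro allI impI UN_mono) auto
  qed auto
  moreover have "prob (\<Inter>n. ?B n) = 0"
  proof -
    have "AE \<omega> in M. \<omega> \<notin> (\<Inter>n. ?B n)"
      using lim
    proof eventually_elim
      case (elim \<omega>)
      from LIMSEQ_D[OF this e] obtain n where "\<forall>m\<ge>n. \<bar>f m \<omega>\<bar> < e" by auto
      then show ?case by (auto intro!: exI[of _ n] simp: not_le)
    qed
    then show ?thesis by (subst prob_eq_0) auto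
  qed
  ultimately obtain n where "prob (?B n) < d"
    using d by (auto dest!: LIMSEQ_D)
  moreover have "prob (?A n) \<le> prob (?B n)"
    by (intro finite_measure_mono) auto
  ultimately have "prob (?A n) < d" by linarith
  then show thesis by (rule that)
qed

text \<open>By continuity from above the limit superior of the events has probability at least
  \<open>p\<close>, and the zero-one law allows only 0 or 1.\<close>

lemma indep_events_infinitely_often:
  assumes ind: "indep_events E (UNIV :: nat set)" and p: "0 < p" "\<And>n. p \<le> prob (E n)"
  shows "AE \<omega> in M. \<exists>\<^sub>F n in sequentially. \<omega> \<in> E n"
proof -
  have E[measurable]: "E n \<in> events" for n
    using ind by (auto simp: indep_events_def)
  let ?B = "\<lambda>n. \<Union>m\<in>{n..}. E m"
  have "(\<lambda>n. prob (?B n)) \<longlonglongrightarrow> prob (\<Inter>n. ?B n)"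
  proof (intro finite_Lim_measure_decseq)
    show "decseq ?B" unfolding decseq_def by (intro allI impI UN_mono) auto
  qed auto
  moreover have "p \<le> prob (?B n)" for n
    using p(2)[of n] by (rule order_trans) (intro finite_measure_mono; auto)
  ultimately have "p \<le> prob (\<Inter>n. ?B n)"
    by (intro LIMSEQ_le_const) auto
  then have "prob (\<Inter>n. ?B n) = 1"
    using borel_0_1_law[OF ind] p(1) by auto
  then have "AE \<omega> in M. \<omega> \<in> (\<Inter>n. ?B n)"
    by (subst (asm) prob_eq_1) auto
  then show ?thesis
    by eventually_elim (auto simp: frequently_sequentially)
qed

end

section \<open>Sampled blocks of a single coordinate\<close>

context real_wiener_process
begin

lemma sampled_functional_measurable_at:
  "0 \<le> s \<Longrightarrow> 0 \<le> h \<Longrightarrow> (\<lambda>\<omega>. sampled_functional (\<lambda>t. B t \<omega>) s h m) \<in> borel_measurable M"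
  by (intro sampled_functional_measurable measurable_at)

context
  fixes s h :: real and n :: nat
  assumes s: "0 \<le> s" and h: "0 < h" and n: "0 < n"
begin

private definition grid :: "nat \<Rightarrow> real" where "grid k = s + real k * (h / real (2 * n))"

private definition incr :: "nat \<Rightarrow> 'w \<Rightarrow> real" where "incr k \<omega> = B (grid (Suc k)) \<omega> - B (grid k) \<omega>"

private lemma indep_incr: "indep_vars (\<lambda>_. borel) incr {..<m}"
  unfolding incr_def using s h n
  by (intro independent_increments) (auto simp: grid_def intro!: divide_right_mono mult_right_mono)

private lemma normal_incr: "distributed M lborel (incr k) (normal_density 0 (sqrt (h / real (2 * n))))"
proof -
  have "0 \<le> grid k" "grid k < grid (Suc k)" "grid (Suc k) - grid k = h / real (2 * n)"
    using s h n by (auto simp: grid_def field_simps)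
  with normal_increments[of "grid k" "grid (Suc k)"] show ?thesis
    by (simp add: incr_def[abs_def])
qed

private lemma sampled_eq:
  "sampled_functional (\<lambda>t. B t \<omega>) s h (2 * n) = h * walk_functional (\<lambda>k. \<Sum>j<k. incr j \<omega>) (2 * n)"
proof -
  have "(\<Sum>j<k. incr j \<omega>) = B (grid k) \<omega> - B s \<omega>" for k
    unfolding incr_def using sum_lessThan_telescope[of "\<lambda>k. B (grid k) \<omega>" k] by (simp add: grid_def)
  then show ?thesis
    by (simp add: sampled_functional_def grid_def)
qed

text \<open>The sampled walk has total variance \<open>h\<close> for every \<open>n\<close>, which
  makes the probability bounds below independent of the mesh.\<close>

private lemma variance_eq: "0 < sqrt (h / real (2 * n))" "real (2 * n) * (sqrt (h / real (2 * n)))\<^sup>2 = h"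
  using h n by auto

lemma prob_sampled_functional_positive:
  "1 / 48 \<le> prob {\<omega> \<in> space M. h\<^sup>2 / 8 \<le> sampled_functional (\<lambda>t. B t \<omega>) s h (2 * n)}"
proof -
  have "h\<^sup>2 / 8 \<le> h * x \<longleftrightarrow> h / 8 \<le> x" for x
    using h by (simp add: power2_eq_square field_simps)
  then show ?thesis
    using walk_functional_positive[OF indep_incr _ variance_eq(1) normal_incr, of "2 * n"] n
    unfolding sampled_eq variance_eq(2) by simp
qed

lemma prob_sampled_functional_negative:
  "exp (-4) / (40 * sqrt pi)
    \<le> prob {\<omega> \<in> space M. sampled_functional (\<lambda>t. B t \<omega>) s h (2 * n) \<le> - (h\<^sup>2 / 800)}"
proof -
  have "h * x \<le> - (h\<^sup>2 / 800) \<longleftrightarrow> x \<le> - (h / 800)" for x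
    using h mult_le_cancel_left_pos[of h x "- (h / 800)"] by (simp add: power2_eq_square)
  then show ?thesis
    using walk_functional_negative[OF n indep_incr variance_eq(1) normal_incr]
    unfolding sampled_eq variance_eq(2) by simp
qed

end

text \<open>Chebyshev at level \<open>real (Suc j) ^ 3\<close> bounds the exceptional probabilities
  by inverse squares, so Borel-Cantelli applies; off these events the quotient is at most
  \<open>1 / real (Suc j)\<close>. A sparse sequence of horizons suffices for choosing one block
  length.\<close>

lemma increments_over_fourth_powers:
  assumes s: "0 \<le> s"
  shows "AE \<omega> in M. (\<lambda>j. (B (s + real (Suc j) ^ 4) \<omega> - B s \<omega>) / real (Suc j) ^ 4) \<longlonglongrightarrow> 0"
proof -
  define V where "V j \<omega> = B (s + real (Suc j) ^ 4) \<omega> - B s \<omega>" for j \<omega>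
  define A where "A j = {\<omega> \<in> space M. real (Suc j) ^ 3 \<le> \<bar>V j \<omega>\<bar>}" for j
  have V[measurable]: "V j \<in> borel_measurable M" for j
    unfolding V_def[abs_def] using s by (intro borel_measurable_diff measurable_at) auto
  have A[measurable]: "A j \<in> events" for j unfolding A_def by measurable
  have prob: "prob (A j) \<le> 1 / real (Suc j) ^ 2" for j
  proof -
    have "distributed M lborel (V j) (normal_density 0 (sqrt (real (Suc j) ^ 4)))"
      unfolding V_def[abs_def] using normal_increments[of s "s + real (Suc j) ^ 4"] s
      by (simp del: of_nat_Suc)
    then have V2: "has_bochner_integral M (\<lambda>\<omega>. (V j \<omega>)\<^sup>2) (real (Suc j) ^ 4)"
      using normal_second_moment[of "sqrt (real (Suc j) ^ 4)" "V j"] by (simp del: of_nat_Suc)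
    have "prob (A j) \<le> real (Suc j) ^ 4 / (real (Suc j) ^ 3)\<^sup>2"
      using second_moment_method[OF V integrable.intros[OF V2], of "real (Suc j) ^ 3"]
      unfolding has_bochner_integral_integral_eq[OF V2] A_def by simp
    also have "\<dots> = 1 / real (Suc j) ^ 2"
      by (simp add: power_mult[symmetric] eval_nat_numeral field_simps del: of_nat_Suc)
    finally show ?thesis .
  qed
  have "summable (\<lambda>j. prob (A j))"
  proof (rule summable_comparison_test)
    show "\<exists>N. \<forall>j\<ge>N. norm (prob (A j)) \<le> 1 / real (Suc j) ^ 2"
      using prob by auto
    show "summable (\<lambda>j. 1 / real (Suc j) ^ 2)"
      using inverse_power_summable[of 2, where ?'a=real]
      by (subst summable_Suc_iff[of "\<lambda>j. 1 / real j ^ 2"]) (simp add: inverse_eq_divide)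
  qed
  then have "AE \<omega> in M. \<forall>\<^sub>F j in sequentially. \<omega> \<in> space M - A j"
    by (intro borel_cantelli_AE1) (auto simp: emeasure_eq_measure)
  then show ?thesis
  proof eventually_elim
    case (elim \<omega>)
    have "(\<lambda>j. V j \<omega> / real (Suc j) ^ 4) \<longlonglongrightarrow> 0"
    proof (rule Lim_null_comparison)
      show "\<forall>\<^sub>F j in sequentially. norm (V j \<omega> / real (Suc j) ^ 4) \<le> inverse (real (Suc j))"
        using elim
      proof eventually_elim
        case (elim j)
        then have "\<bar>V j \<omega>\<bar> \<le> real (Suc j) ^ 3" by (auto simp: A_def)
        then have "\<bar>V j \<omega>\<bar> / real (Suc j) ^ 4 \<le> real (Suc j) ^ 3 / real (Suc j) ^ 4"
          by (rule divide_right_mono) simp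
        also have "\<dots> = inverse (real (Suc j))"
          by (simp add: eval_nat_numeral field_simps del: of_nat_Suc)
        finally show ?case by (simp add: abs_divide del: of_nat_Suc)
      qed
    qed (rule LIMSEQ_inverse_real_of_nat)
    then show ?case unfolding V_def .
  qed
qed

text \<open>Block ends are integers and meshes are dyadic, so finitely many blocks share one fine
  grid. Each block is then a function of the fine increments in its own index set, and these sets
  are disjoint.\<close>

lemma indep_sampled_functionals:
  fixes t l :: "nat \<Rightarrow> nat"
  assumes t: "\<And>n. t n \<le> t (Suc n)"
  shows "indep_vars (\<lambda>_. borel)
    (\<lambda>n \<omega>. sampled_functional (\<lambda>\<tau>. B \<tau> \<omega>) (real (t n)) (real (t (Suc n) - t n)) (2 ^ l n)) {..<N}"
proof -
  \<comment> \<open>\<open>2 ^ L\<close> subdivisions per unit of time refine the grids of all \<open>N\<close> blocks.\<close>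
  define L where "L = (\<Sum>n<N. l n)"
  have lL: "l n \<le> L" if "n < N" for n
    unfolding L_def using that by (intro member_le_sum) auto
  define X where "X k \<omega> = B (real (Suc k) / 2 ^ L) \<omega> - B (real k / 2 ^ L) \<omega>" for k \<omega>
  define K where "K n = {t n * 2 ^ L ..< t (Suc n) * 2 ^ L}" for n
  \<comment> \<open>The number of fine cells in one cell of block \<open>n\<close>; the subtraction
    is exact because \<open>l n \<le> L\<close>.\<close>
  define step where "step n = (t (Suc n) - t n) * 2 ^ (L - l n)" for n
  define F where "F n x = real (t (Suc n) - t n) *
      walk_functional (\<lambda>k. \<Sum>j=t n * 2 ^ L..<t n * 2 ^ L + k * step n. x j) (2 ^ l n)"
    for n and x :: "nat \<Rightarrow> real"
  have mono: "t m \<le> t n" if "m \<le> n" for m n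
    using lift_Suc_mono_le[of t m n] t that by blast
  have indX: "indep_vars (\<lambda>_. borel) X {..<t N * 2 ^ L}"
    unfolding X_def by (intro independent_increments) (auto intro!: divide_right_mono)
  have step: "2 ^ l n * step n = (t (Suc n) - t n) * 2 ^ L" if "n < N" for n
    using lL[OF that] by (simp add: step_def power_add[symmetric])
  have sub: "{t n * 2 ^ L..<t n * 2 ^ L + k * step n} \<subseteq> K n" if "n < N" "k \<le> 2 ^ l n" for n k
  proof -
    have "k * step n \<le> 2 ^ l n * step n" using that(2) by (rule mult_right_mono) simp
    then have "t n * 2 ^ L + k * step n \<le> (t n + (t (Suc n) - t n)) * 2 ^ L"
      unfolding step[OF that(1)] by (simp add: distrib_right)
    then show ?thesis using t[of n] by (auto simp: K_def)
  qed
  have "indep_vars (\<lambda>_. borel) (\<lambda>n \<omega>. F n (restrict (\<lambda>k. X k \<omega>) (K n))) {..<N}"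
  proof (intro indep_vars_compose2[OF indep_vars_restrict[OF indX]])
    show "K n \<subseteq> {..<t N * 2 ^ L}" if "n \<in> {..<N}" for n
      using mono[of "Suc n" N] that by (auto simp: K_def intro: less_le_trans)
    show "disjoint_family_on K {..<N}"
    proof -
      have "K m \<inter> K n = {}" if "m < n" for m n
        using mono[of "Suc m" n] that by (auto simp: K_def dest: less_le_trans[of _ "t (Suc m) * 2 ^ L"])
      then show ?thesis
        unfolding disjoint_family_on_def by (metis inf_commute linorder_neqE_nat)
    qed
    show "F n \<in> borel_measurable (PiM (K n) (\<lambda>_. borel))" if "n \<in> {..<N}" for n
      unfolding F_def[abs_def] walk_functional_def
      using that
      by (intro borel_measurable_times borel_measurable_diff borel_measurable_divide borel_measurable_sum
          borel_measurable_power borel_measurable_const measurable_component_singleton) (auto intro: subsetD[OF sub])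
  qed
  also have "?this \<longleftrightarrow> ?thesis"
  proof (intro indep_vars_cong refl)
    fix n assume n: "n \<in> {..<N}"
    show "(\<lambda>\<omega>. F n (restrict (\<lambda>k. X k \<omega>) (K n))) = (\<lambda>\<omega>. sampled_functional (\<lambda>\<tau>. B \<tau> \<omega>) (real (t n))
        (real (t (Suc n) - t n)) (2 ^ l n))"
    proof
      fix \<omega>
      have "(\<Sum>j=t n * 2 ^ L..<t n * 2 ^ L + k * step n. restrict (\<lambda>k. X k \<omega>) (K n) j)
          = B (real (t n) + real k * (real (t (Suc n) - t n) / real (2 ^ l n))) \<omega> - B (real (t n)) \<omega>"
        if k: "k \<le> 2 ^ l n" for k
      proof -
        have "(\<Sum>j=t n * 2 ^ L..<t n * 2 ^ L + k * step n. restrict (\<lambda>k. X k \<omega>) (K n) j)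
            = (\<Sum>j=t n * 2 ^ L..<t n * 2 ^ L + k * step n. B (real (Suc j) / 2 ^ L) \<omega> - B (real j / 2 ^ L) \<omega>)"
          using sub[of n k] n k by (intro sum.cong) (auto simp: X_def)
        also have "\<dots> = B (real (t n * 2 ^ L + k * step n) / 2 ^ L) \<omega> - B (real (t n * 2 ^ L) / 2 ^ L) \<omega>"
          by (rule sum_Suc_diff') simp
        also have "real (t n * 2 ^ L) / 2 ^ L = real (t n)" by simp
        also have "real (t n * 2 ^ L + k * step n) / 2 ^ L
            = real (t n) + real k * (real (t (Suc n) - t n) / real (2 ^ l n))"
        proof -
          have "real (2 ^ l n * step n) = real ((t (Suc n) - t n) * 2 ^ L)"
            using n by (subst step) auto
          then have "real (step n) / 2 ^ L = real (t (Suc n) - t n) / real (2 ^ l n)"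
            by (simp add: field_simps)
          then show ?thesis
            by (simp add: add_divide_distrib flip: times_divide_eq_right)
        qed
        finally show ?thesis .
      qed
      then show "F n (restrict (\<lambda>k. X k \<omega>) (K n)) = sampled_functional (\<lambda>\<tau>. B \<tau> \<omega>) (real (t n))
          (real (t (Suc n) - t n)) (2 ^ l n)"
        by (simp add: F_def sampled_functional_def walk_functional_def)
    qed
  qed
  finally show ?thesis .
qed

end

section \<open>Joint independence of the blocks and approximation of \<open>Y\<close>\<close>

context wiener_process
begin

definition block_functional :: "(nat \<Rightarrow> nat) \<Rightarrow> (nat \<Rightarrow> nat) \<Rightarrow> 'd \<Rightarrow> nat \<Rightarrow> 'w \<Rightarrow> real" where
  "block_functional t l i n \<omega> =
     sampled_functional (\<lambda>\<tau>. W \<tau> \<omega> $ i) (real (t n)) (real (t (Suc n) - t n)) (2 ^ l n)"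

lemma block_functional_measurable[measurable]:
  "block_functional t l i n \<in> borel_measurable M"
  unfolding block_functional_def[abs_def]
  by (rule real_wiener_process.sampled_functional_measurable_at[OF wiener_components]) auto

text \<open>Independence is used twice: the coordinates are independent as random paths, so events
  about the whole family of blocks in \<open>J\<close> factor over \<open>i\<close>; within one
  coordinate the blocks factor over \<open>n\<close>.\<close>

lemma prob_block_events:
  assumes t: "\<And>n. t n \<le> t (Suc n)" and Q[measurable]: "\<And>n. Measurable.pred borel (Q n)"
    and J: "finite J" "J \<noteq> {}"
  shows "prob {\<omega> \<in> space M. \<forall>n\<in>J. \<forall>i. Q n (block_functional t l i n \<omega>)}
    = (\<Prod>n\<in>J. \<Prod>i\<in>UNIV. prob {\<omega> \<in> space M. Q n (block_functional t l i n \<omega>)})"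
proof -
  let ?P = "PiM {0..} (\<lambda>_. borel :: real measure)"
  let ?X = "\<lambda>i \<omega>. \<lambda>t\<in>{0..}. W t \<omega> $ i"
  define A where "A = {x \<in> space ?P. \<forall>n\<in>J. Q n (sampled_functional x (real (t n)) (real (t (Suc n) - t n)) (2 ^ l n))}"
  have [measurable]: "(\<lambda>x. sampled_functional x (real (t n)) (real (t (Suc n) - t n)) (2 ^ l n)) \<in> borel_measurable ?P" for n
    by (intro sampled_functional_measurable measurable_component_singleton) auto
  have A: "A \<in> sets ?P"
    unfolding A_def using J(1) by measurable
  have XA: "?X i -` A \<inter> space M = {\<omega> \<in> space M. \<forall>n\<in>J. Q n (block_functional t l i n \<omega>)}" for i
    by (auto simp: A_def block_functional_def sampled_functional_restrict space_PiM)
  have "{\<omega> \<in> space M. \<forall>n\<in>J. \<forall>i. Q n (block_functional t l i n \<omega>)} = (\<Inter>i\<in>UNIV. ?X i -` A \<inter> space M)"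
    unfolding XA by auto
  also have "prob \<dots> = (\<Prod>i\<in>UNIV. prob (?X i -` A \<inter> space M))"
    by (rule indep_varsD[OF independent_components]) (auto simp: A)
  also have "\<dots> = (\<Prod>i\<in>UNIV. \<Prod>n\<in>J. prob {\<omega> \<in> space M. Q n (block_functional t l i n \<omega>)})"
  proof (intro prod.cong refl)
    fix i
    obtain N where N: "J \<subseteq> {..<N}" using finite_nat_iff_bounded J(1) by blast
    interpret real_wiener_process M "\<lambda>t \<omega>. W t \<omega> $ i" by (rule wiener_components)
    have "indep_vars (\<lambda>_. borel) (block_functional t l i) {..<N}"
      unfolding block_functional_def[abs_def] by (rule indep_sampled_functionals[where t = t, OF t])
    from indep_varsD[OF this J(2,1) N, of "\<lambda>n. {x. Q n x}"]
    have "prob (\<Inter>n\<in>J. block_functional t l i n -` {x. Q n x} \<inter> space M)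
        = (\<Prod>n\<in>J. prob (block_functional t l i n -` {x. Q n x} \<inter> space M))"
      using Q by (simp add: pred_def)
    moreover have v: "block_functional t l i n -` {x. Q n x} \<inter> space M
        = {\<omega> \<in> space M. Q n (block_functional t l i n \<omega>)}" for n
      by auto
    moreover have XJ: "(\<Inter>n\<in>J. {\<omega> \<in> space M. Q n (block_functional t l i n \<omega>)}) = ?X i -` A \<inter> space M"
      unfolding XA using J(2) by auto
    ultimately show "prob (?X i -` A \<inter> space M)
        = (\<Prod>n\<in>J. prob {\<omega> \<in> space M. Q n (block_functional t l i n \<omega>)})"
      by (simp only: v XJ)
  qed
  also have "\<dots> = (\<Prod>n\<in>J. \<Prod>i\<in>UNIV. prob {\<omega> \<in> space M. Q n (block_functional t l i n \<omega>)})"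
    by (rule prod.swap)
  finally show ?thesis .
qed

text \<open>All coordinates satisfy the condition at once with probability at least
  \<open>p ^ CARD('d)\<close>, and these joint events are independent in \<open>n\<close>: the case
  of singletons identifies the factors in the product formula.\<close>

lemma block_events_infinitely_often:
  assumes t: "\<And>n. t n \<le> t (Suc n)" and Q: "\<And>n. Measurable.pred borel (Q n)"
    and p: "0 < p" "\<And>n i. p \<le> prob {\<omega> \<in> space M. Q n (block_functional t l i n \<omega>)}"
  shows "AE \<omega> in M. \<exists>\<^sub>F n in sequentially. \<forall>i. Q n (block_functional t l i n \<omega>)"
proof -
  let ?E = "\<lambda>n. {\<omega> \<in> space M. \<forall>i. Q n (block_functional t l i n \<omega>)}"
  note pb = prob_block_events[where t = t and Q = Q and l = l, OF t Q]
  have single: "prob (?E n) = (\<Prod>i\<in>UNIV. prob {\<omega> \<in> space M. Q n (block_functional t l i n \<omega>)})" for n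
    using pb[of "{n}"] by simp
  have "indep_events ?E UNIV"
  proof (rule indep_eventsI)
    show "?E n \<in> events" for n using Q[of n] by measurable
    fix J :: "nat set" assume J: "finite J" "J \<noteq> {}"
    then have "(\<Inter>n\<in>J. ?E n) = {\<omega> \<in> space M. \<forall>n\<in>J. \<forall>i. Q n (block_functional t l i n \<omega>)}" by auto
    then show "prob (\<Inter>n\<in>J. ?E n) = (\<Prod>n\<in>J. prob (?E n))"
      using pb[OF J] single by simp
  qed
  moreover have "p ^ CARD('d) \<le> prob (?E n)" for n
    unfolding single using prod_mono[of "UNIV :: 'd set" "\<lambda>_. p"] p by (simp add: less_imp_le)
  ultimately have "AE \<omega> in M. \<exists>\<^sub>F n in sequentially. \<omega> \<in> ?E n"
    using p(1) by (intro indep_events_infinitely_often[of _ "p ^ CARD('d)"]) auto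
  then show ?thesis
    by eventually_elim (auto elim: frequently_elim1)
qed

text \<open>The set of regular paths need not be measurable; the complement of a null set containing
  all exceptions is a measurable substitute.\<close>

lemma regular_paths:
  assumes W0: "AE \<omega> in M. W 0 \<omega> = 0"
  obtains \<Omega> where "\<Omega> \<in> events" "AE \<omega> in M. \<omega> \<in> \<Omega>"
    "\<And>\<omega> i. \<omega> \<in> \<Omega> \<Longrightarrow> continuous_on {0..} (\<lambda>t. W t \<omega> $ i)" "\<And>\<omega> i. \<omega> \<in> \<Omega> \<Longrightarrow> W 0 \<omega> $ i = 0"
proof -
  have "AE \<omega> in M. \<forall>i. continuous_on {0..} (\<lambda>t. W t \<omega> $ i)"
    unfolding AE_all_countable
    using real_wiener_process.continuous_paths[OF wiener_components] by blast
  with W0 have "AE \<omega> in M. (\<forall>i. continuous_on {0..} (\<lambda>t. W t \<omega> $ i)) \<and> W 0 \<omega> = 0"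
    by eventually_elim auto
  then obtain N where N: "N \<in> null_sets M"
    "{\<omega> \<in> space M. \<not> ((\<forall>i. continuous_on {0..} (\<lambda>t. W t \<omega> $ i)) \<and> W 0 \<omega> = 0)} \<subseteq> N"
    unfolding eventually_ae_filter by blast
  show thesis
  proof (rule that[of "space M - N"])
    show "AE \<omega> in M. \<omega> \<in> space M - N"
      using AE_not_in[OF N(1)] AE_space by eventually_elim auto
  qed (use N in auto)
qed

text \<open>Two limits are taken in turn. First \<open>h\<close> is chosen so large that the shift
  correction is small against its square, then, with \<open>h\<close> fixed, the mesh so fine that
  sampling costs little. Each choice spends half of \<open>c\<close> and half of
  \<open>d\<close>.\<close>

lemma block_approximation:
  assumes W0: "AE \<omega> in M. W 0 \<omega> = 0" and c: "0 < c" and d: "0 < d"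
  shows "\<exists>h l N. 0 < h \<and> 0 < l \<and> N \<in> events \<and> prob N < d \<and>
    (AE \<omega> in M. \<omega> \<notin> N \<longrightarrow> \<bar>Y_process W (real (s + h)) \<omega>
        - (\<Sum>i\<in>UNIV. sampled_functional (\<lambda>t. W t \<omega> $ i) (real s) (real h) (2 ^ l))\<bar> < c * (real h)\<^sup>2)"
proof -
  obtain \<Omega> where \<Omega>[measurable]: "\<Omega> \<in> events" and AE_\<Omega>: "AE \<omega> in M. \<omega> \<in> \<Omega>"
    and cont: "\<And>\<omega> i. \<omega> \<in> \<Omega> \<Longrightarrow> continuous_on {0..} (\<lambda>t. W t \<omega> $ i)"
    and zero: "\<And>\<omega> i. \<omega> \<in> \<Omega> \<Longrightarrow> W 0 \<omega> $ i = 0"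
    using regular_paths[OF W0] by blast
  have sampled[measurable]: "(\<lambda>\<omega>. sampled_functional (\<lambda>t. W t \<omega> $ i) s h m) \<in> borel_measurable M"
    if "0 \<le> s" "0 \<le> h" for i s h m
    using real_wiener_process.sampled_functional_measurable_at[OF wiener_components that] .
  \<comment> \<open>The exponent \<open>Suc l\<close> is positive, so the number of cells is even,
    as the bounds for sampled blocks require.\<close>
  have pow: "filterlim (\<lambda>l. 2 ^ Suc l :: nat) sequentially sequentially"
    by (intro filterlim_subseq strict_monoI_Suc) auto
  \<comment> \<open>The indicator makes \<open>g\<close> an everywhere limit of measurable functions; \<open>path_functional\<close> itself
      need not be measurable in \<open>\<omega>\<close>, as paths are continuous only almost surely.\<close>
  define g where "g i s h \<omega> = indicator \<Omega> \<omega> * path_functional (\<lambda>t. W t \<omega> $ i) s h" for i s h \<omega>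
  have g[measurable]: "g i s h \<in> borel_measurable M" if "0 \<le> s" "0 < h" for i s h
  proof (rule borel_measurable_LIMSEQ_real)
    fix \<omega>
    show "(\<lambda>m. indicator \<Omega> \<omega> * sampled_functional (\<lambda>t. W t \<omega> $ i) s h m) \<longlonglongrightarrow> g i s h \<omega>"
      unfolding g_def using cont[of \<omega> i] that
      by (cases "\<omega> \<in> \<Omega>") (auto intro!: sampled_functional_tendsto)
    show "(\<lambda>\<omega>. indicator \<Omega> \<omega> * sampled_functional (\<lambda>t. W t \<omega> $ i) s h m) \<in> borel_measurable M" for m
      using that less_imp_le[OF that(2)] by measurable
  qed
  define H where "H j = Suc j ^ 4" for j
  have H: "0 < H j" for j by (simp add: H_def)
  have H_top: "filterlim (\<lambda>j. real (H j)) at_top sequentially"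
    unfolding H_def by real_asymp
  define f where "f j \<omega> = (\<Sum>i\<in>UNIV. \<bar>g i 0 (real s + real (H j)) \<omega> - g i (real s) (real (H j)) \<omega>\<bar> / (real (H j))\<^sup>2)" for j \<omega>
  have f[measurable]: "f j \<in> borel_measurable M" for j
    unfolding f_def[abs_def] using H[of j]
    by (intro borel_measurable_sum borel_measurable_divide borel_measurable_abs borel_measurable_diff g
        borel_measurable_const) auto
  have "AE \<omega> in M. \<forall>i. (\<lambda>j. (W (real s + real (H j)) \<omega> $ i - W (real s) \<omega> $ i) / real (H j)) \<longlonglongrightarrow> 0"
    unfolding AE_all_countable H_def
    using real_wiener_process.increments_over_fourth_powers[OF wiener_components, of "real s"] by simp
  then have f_lim: "AE \<omega> in M. (\<lambda>j. f j \<omega>) \<longlonglongrightarrow> 0"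
    using AE_\<Omega>
  proof eventually_elim
    case (elim \<omega>)
    have "(\<lambda>j. \<bar>g i 0 (real s + real (H j)) \<omega> - g i (real s) (real (H j)) \<omega>\<bar> / (real (H j))\<^sup>2) \<longlonglongrightarrow> 0" for i
    proof -
      let ?w = "\<lambda>t. W t \<omega> $ i"
      let ?v = "\<lambda>j. (?w (real s + real (H j)) - ?w (real s)) / real (H j)"
      let ?e = "\<lambda>j. inverse (real (H j))"
      \<comment> \<open>This is the correction from \<open>path_functional_shift\<close> divided by
        the square of the block length; every summand contains a factor tending to 0, either
        \<open>?e\<close> or \<open>?v\<close>.\<close>
      have "(\<lambda>j. path_functional ?w 0 (real s) * (?e j)\<^sup>2 + 1 / 2 * (?w (real s))\<^sup>2 * ?e j
          + ?v j * (integral {0..real s} ?w * ?e j + ?w (real s))) \<longlonglongrightarrow>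
          path_functional ?w 0 (real s) * 0\<^sup>2 + 1 / 2 * (?w (real s))\<^sup>2 * 0
          + 0 * (integral {0..real s} ?w * 0 + ?w (real s))"
        using elim(1) by (intro tendsto_intros tendsto_inverse_0_at_top[OF H_top]) auto
      moreover have "path_functional ?w 0 (real s) * (?e j)\<^sup>2 + 1 / 2 * (?w (real s))\<^sup>2 * ?e j
          + ?v j * (integral {0..real s} ?w * ?e j + ?w (real s))
        = (g i 0 (real s + real (H j)) \<omega> - g i (real s) (real (H j)) \<omega>) / (real (H j))\<^sup>2" for j
      proof -
        have "g i 0 (real s + real (H j)) \<omega> - g i (real s) (real (H j)) \<omega>
          = path_functional ?w 0 (real s) + 1 / 2 * real (H j) * (?w (real s))\<^sup>2
            + (?w (real s + real (H j)) - ?w (real s)) * (integral {0..real s} ?w + real (H j) * ?w (real s))"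
          unfolding g_def using elim(2) cont[OF elim(2)] zero[OF elim(2)]
          by (simp add: path_functional_shift)
        moreover have "P * (inverse r)\<^sup>2 + 1 / 2 * w\<^sup>2 * inverse r + (x - w) / r * (I * inverse r + w)
            = (P + 1 / 2 * r * w\<^sup>2 + (x - w) * (I + r * w)) / r\<^sup>2" if "0 < r" for P w x I r :: real
          using that by (simp add: field_simps power2_eq_square)
        ultimately show ?thesis
          using H[of j] by (simp only: of_nat_0_less_iff)
      qed
      ultimately have "(\<lambda>j. (g i 0 (real s + real (H j)) \<omega> - g i (real s) (real (H j)) \<omega>) / (real (H j))\<^sup>2) \<longlonglongrightarrow> 0"
        by simp
      from tendsto_rabs_zero[OF this] show ?thesis by simp
    qed
    then show ?case unfolding f_def by (intro tendsto_null_sum) auto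
  qed
  obtain j where j: "prob {\<omega> \<in> space M. c / 2 \<le> \<bar>f j \<omega>\<bar>} < d / 2"
    by (rule AE_tendsto_0_imp_prob_less[where e = "c / 2" and d = "d / 2", OF f f_lim]) (use c d in auto)
  define h where "h = H j"
  have h: "0 < h" using H by (simp add: h_def)
  define k where "k l \<omega> = (\<Sum>i\<in>UNIV. \<bar>g i (real s) (real h) \<omega>
      - sampled_functional (\<lambda>t. W t \<omega> $ i) (real s) (real h) (2 ^ Suc l)\<bar> / (real h)\<^sup>2)" for l \<omega>
  have k[measurable]: "k l \<in> borel_measurable M" for l
    unfolding k_def[abs_def] using h
    by (intro borel_measurable_sum borel_measurable_divide borel_measurable_abs borel_measurable_diff g
        sampled borel_measurable_const) auto
  have k_lim: "AE \<omega> in M. (\<lambda>l. k l \<omega>) \<longlonglongrightarrow> 0"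
    using AE_\<Omega>
  proof eventually_elim
    case (elim \<omega>)
    have "(\<lambda>l. \<bar>g i (real s) (real h) \<omega>
        - sampled_functional (\<lambda>t. W t \<omega> $ i) (real s) (real h) (2 ^ Suc l)\<bar> / (real h)\<^sup>2) \<longlonglongrightarrow> \<bar>g i (real s) (real h) \<omega> - g i (real s) (real h) \<omega>\<bar> / (real h)\<^sup>2" for i
    proof (intro tendsto_intros)
      show "(\<lambda>l. sampled_functional (\<lambda>t. W t \<omega> $ i) (real s) (real h) (2 ^ Suc l)) \<longlonglongrightarrow> g i (real s) (real h) \<omega>"
        using filterlim_compose[OF sampled_functional_tendsto[OF _ _ cont[OF elim], of "real h" "real s" i] pow] h elim
        by (simp add: g_def)
    qed (use h in simp)
    then show ?case unfolding k_def by (intro tendsto_null_sum) auto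
  qed
  obtain l where l: "prob {\<omega> \<in> space M. c / 2 \<le> \<bar>k l \<omega>\<bar>} < d / 2"
    by (rule AE_tendsto_0_imp_prob_less[where e = "c / 2" and d = "d / 2", OF k k_lim]) (use c d in auto)
  let ?N = "{\<omega> \<in> space M. c / 2 \<le> \<bar>f j \<omega>\<bar>} \<union> {\<omega> \<in> space M. c / 2 \<le> \<bar>k l \<omega>\<bar>}"
  have N: "?N \<in> events" by measurable
  have "prob ?N \<le> prob {\<omega> \<in> space M. c / 2 \<le> \<bar>f j \<omega>\<bar>} + prob {\<omega> \<in> space M. c / 2 \<le> \<bar>k l \<omega>\<bar>}"
    by (intro measure_Un_le) measurable
  then have pN: "prob ?N < d" using j l by linarith
  have "AE \<omega> in M. \<omega> \<notin> ?N \<longrightarrow> \<bar>Y_process W (real (s + h)) \<omega>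
        - (\<Sum>i\<in>UNIV. sampled_functional (\<lambda>t. W t \<omega> $ i) (real s) (real h) (2 ^ Suc l))\<bar> < c * (real h)\<^sup>2"
    using AE_\<Omega> AE_space
  proof (eventually_elim, intro impI)
    fix \<omega> assume \<omega>: "\<omega> \<in> \<Omega>" "\<omega> \<in> space M" "\<omega> \<notin> ?N"
    let ?R = "\<lambda>i. sampled_functional (\<lambda>t. W t \<omega> $ i) (real s) (real h) (2 ^ Suc l)"
    have "Y_process W (real (s + h)) \<omega> = (\<Sum>i\<in>UNIV. g i 0 (real s + real h) \<omega>)"
      using \<omega>(1) by (simp add: Y_process_eq_sum cont zero g_def)
    then have "\<bar>Y_process W (real (s + h)) \<omega> - (\<Sum>i\<in>UNIV. ?R i)\<bar>
        = \<bar>\<Sum>i\<in>UNIV. (g i 0 (real s + real h) \<omega> - g i (real s) (real h) \<omega>) + (g i (real s) (real h) \<omega> - ?R i)\<bar>"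
      by (simp add: sum_subtractf)
    also have "\<dots> \<le> (\<Sum>i\<in>UNIV. \<bar>(g i 0 (real s + real h) \<omega> - g i (real s) (real h) \<omega>) + (g i (real s) (real h) \<omega> - ?R i)\<bar>)"
      by (rule sum_abs)
    also have "\<dots> \<le> (\<Sum>i\<in>UNIV. \<bar>g i 0 (real s + real h) \<omega> - g i (real s) (real h) \<omega>\<bar> + \<bar>g i (real s) (real h) \<omega> - ?R i\<bar>)"
      by (intro sum_mono abs_triangle_ineq)
    also have "\<dots> = (f j \<omega> + k l \<omega>) * (real h)\<^sup>2"
      using h by (simp add: f_def k_def h_def[symmetric] sum.distrib distrib_right sum_distrib_right)
    also have "\<dots> < c * (real h)\<^sup>2"
      using \<omega> h by (intro mult_strict_right_mono) (auto simp: not_le)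
    finally show "\<bar>Y_process W (real (s + h)) \<omega> - (\<Sum>i\<in>UNIV. ?R i)\<bar> < c * (real h)\<^sup>2" .
  qed
  then show ?thesis
    using h N pN by (intro exI[of _ h] exI[of _ "Suc l"] exI[of _ ?N]) auto
qed

end

section \<open>Choice of the times and conclusion by changes of sign\<close>

theorem corollary5p10:
  fixes M :: "'w measure" and W :: "real \<Rightarrow> 'w \<Rightarrow> real ^ 'd"
  assumes "wiener_process M W"
    and "AE \<omega> in M. W 0 \<omega> = 0"
  shows "AE \<omega> in M. \<exists>t :: nat \<Rightarrow> real. strict_mono t \<and> \<not> bdd_above (range t) \<and>
           (\<forall>n. 0 \<le> t n \<and> Y_process W (t n) \<omega> = 0)"
proof -
  interpret wiener_process M W by fact
  \<comment> \<open>Any positive value below 1/800, the smaller of the two block thresholds, lets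
    the sign of the block sum pass to \<open>Y\<close>.\<close>
  define c :: real where "c = 1 / 1000"
  define approx where "approx s n h l N \<longleftrightarrow> 0 < h \<and> 0 < l \<and> N \<in> events \<and> prob N < (1 / 2) ^ n \<and>
    (AE \<omega> in M. \<omega> \<notin> N \<longrightarrow> \<bar>Y_process W (real (s + h)) \<omega>
        - (\<Sum>i\<in>UNIV. sampled_functional (\<lambda>t. W t \<omega> $ i) (real s) (real h) (2 ^ l))\<bar> < c * (real h)\<^sup>2)"
    for s n h l :: nat and N
  have "\<exists>h l N. approx s n h l N" for s n
    unfolding approx_def by (intro block_approximation assms(2)) (simp_all add: c_def)
  then obtain step level bad where choice: "\<And>s n. approx s n (step s n) (level s n) (bad s n)"
    by metis
  \<comment> \<open>Block length, level and exceptional set depend on the time already reached and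
    on \<open>n\<close>; the exceptional probability is below \<open>(1 / 2) ^ n\<close>, so
    Borel-Cantelli makes the approximation valid for all large \<open>n\<close>.\<close>
  define t where "t = rec_nat 0 (\<lambda>n s. s + step s n)"
  define l where "l n = level (t n) n" for n
  define N where "N n = bad (t n) n" for n
  define h where "h n = real (t (Suc n) - t n)" for n
  have Suc: "t (Suc n) = t n + step (t n) n" for n by (simp add: t_def)
  have t_less: "t n < t (Suc n)" for n
    using choice[of "t n" n] unfolding approx_def by (simp add: Suc)
  have t_ge: "n \<le> t n" for n
    using strict_mono_imp_increasing[of t n] t_less by (simp add: strict_mono_Suc_iff)
  have h: "0 < h n" for n using t_less[of n] by (simp add: h_def)
  \<comment> \<open>This exhibits the number of cells in the form \<open>2 * n\<close> of the
    single-coordinate bounds.\<close>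
  have l: "2 ^ l n = 2 * 2 ^ (l n - 1)" for n
    using choice[of "t n" n] unfolding approx_def l_def[symmetric] by (cases "l n") auto
  have N: "N n \<in> events" "prob (N n) \<le> (1 / 2) ^ n" for n
    using choice[of "t n" n] unfolding approx_def by (auto simp: N_def)
  have "summable (\<lambda>n. prob (N n))"
    by (rule summable_comparison_test[OF _ summable_geometric[of "1 / 2 :: real"]]) (use N(2) in auto)
  then have good: "AE \<omega> in M. \<forall>\<^sub>F n in sequentially. \<omega> \<in> space M - N n"
    by (intro borel_cantelli_AE1 N(1)) (auto simp: emeasure_eq_measure)
  have close: "AE \<omega> in M. \<forall>n. \<omega> \<notin> N n \<longrightarrow>
      \<bar>Y_process W (real (t (Suc n))) \<omega> - (\<Sum>i\<in>UNIV. block_functional t l i n \<omega>)\<bar> < c * (h n)\<^sup>2"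
    unfolding AE_all_countable
  proof
    fix n
    show "AE \<omega> in M. \<omega> \<notin> N n \<longrightarrow>
      \<bar>Y_process W (real (t (Suc n))) \<omega> - (\<Sum>i\<in>UNIV. block_functional t l i n \<omega>)\<bar> < c * (h n)\<^sup>2"
      using choice[of "t n" n]
      unfolding approx_def block_functional_def N_def l_def h_def Suc add_diff_cancel_left' by blast
  qed
  have pos: "AE \<omega> in M. \<exists>\<^sub>F n in sequentially. \<forall>i. (h n)\<^sup>2 / 8 \<le> block_functional t l i n \<omega>"
  proof (rule block_events_infinitely_often)
    show "1 / 48 \<le> prob {\<omega> \<in> space M. (h n)\<^sup>2 / 8 \<le> block_functional t l i n \<omega>}" for n i
      unfolding block_functional_def l h_def[symmetric]
      by (rule real_wiener_process.prob_sampled_functional_positive[OF wiener_components]) (auto simp: h)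
  qed (auto simp: t_less less_imp_le)
  have neg: "AE \<omega> in M. \<exists>\<^sub>F n in sequentially. \<forall>i. block_functional t l i n \<omega> \<le> - ((h n)\<^sup>2 / 800)"
  proof (rule block_events_infinitely_often)
    show "exp (-4) / (40 * sqrt pi) \<le> prob {\<omega> \<in> space M. block_functional t l i n \<omega> \<le> - ((h n)\<^sup>2 / 800)}" for n i
      unfolding block_functional_def l h_def[symmetric]
      by (rule real_wiener_process.prob_sampled_functional_negative[OF wiener_components]) (auto simp: h)
  qed (auto simp: t_less less_imp_le)
  have cont: "AE \<omega> in M. \<forall>i. continuous_on {0..} (\<lambda>t. W t \<omega> $ i)"
    unfolding AE_all_countable
    using real_wiener_process.continuous_paths[OF wiener_components] by blast
  show ?thesis
    using good close pos neg cont
  proof eventually_elim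
    case (elim \<omega>)
    have late: "\<exists>t\<ge>T. P (Y_process W t \<omega>)"
      if "\<exists>\<^sub>F n in sequentially. P (Y_process W (real (t (Suc n))) \<omega>)" for T P
    proof -
      from that[unfolded frequently_sequentially, rule_format, of "nat \<lceil>T\<rceil>"]
      obtain n where n: "nat \<lceil>T\<rceil> \<le> n" "P (Y_process W (real (t (Suc n))) \<omega>)"
        by (elim exE conjE)
      have "T \<le> real (t (Suc n))"
        using n(1) t_ge[of "Suc n"] by linarith
      with n(2) show ?thesis
        by (intro exI[of _ "real (t (Suc n))"] conjI)
    qed
    have h2: "0 < (h n)\<^sup>2" for n using h[of n] by simp
    \<comment> \<open>Summing a threshold over the coordinates gives at least its value for one
      coordinate, so a \<open>c\<close> independent of the dimension suffices.\<close>
    have card: "(h n)\<^sup>2 \<le> real CARD('d) * (h n)\<^sup>2" for n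
      using mult_right_mono[of 1 "real CARD('d)" "(h n)\<^sup>2"] by simp
    show ?case
    proof (rule unbounded_zeros)
      show "continuous_on {0..T} (\<lambda>t. Y_process W t \<omega>)" for T
        using elim(5) by (intro continuous_on_Y_process) auto
      show "\<exists>t\<ge>T. 0 < Y_process W t \<omega>" for T
      proof (rule late, rule frequently_rev_mp[OF elim(3)], rule eventually_mono[OF elim(1)], intro impI)
        fix n assume n: "\<omega> \<in> space M - N n" "\<forall>i. (h n)\<^sup>2 / 8 \<le> block_functional t l i n \<omega>"
        have "real CARD('d) * (h n)\<^sup>2 / 8 \<le> (\<Sum>i\<in>UNIV. block_functional t l i n \<omega>)"
          using n(2) sum_mono[of UNIV "\<lambda>_::'d. (h n)\<^sup>2 / 8"] by simp
        moreover have "\<bar>Y_process W (real (t (Suc n))) \<omega> - (\<Sum>i\<in>UNIV. block_functional t l i n \<omega>)\<bar> < c * (h n)\<^sup>2"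
          using elim(2) n(1) by blast
        ultimately show "0 < Y_process W (real (t (Suc n))) \<omega>"
          using card[of n] h2[of n] unfolding c_def by linarith
      qed
      show "\<exists>t\<ge>T. Y_process W t \<omega> < 0" for T
      proof (rule late, rule frequently_rev_mp[OF elim(4)], rule eventually_mono[OF elim(1)], intro impI)
        fix n assume n: "\<omega> \<in> space M - N n" "\<forall>i. block_functional t l i n \<omega> \<le> - ((h n)\<^sup>2 / 800)"
        have "(\<Sum>i\<in>UNIV. block_functional t l i n \<omega>) \<le> - (real CARD('d) * (h n)\<^sup>2 / 800)"
          using n(2) sum_mono[of UNIV _ "\<lambda>_::'d. - ((h n)\<^sup>2 / 800)"] by simp
        moreover have "\<bar>Y_process W (real (t (Suc n))) \<omega> - (\<Sum>i\<in>UNIV. block_functional t l i n \<omega>)\<bar> < c * (h n)\<^sup>2"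
          using elim(2) n(1) by blast
        ultimately show "Y_process W (real (t (Suc n))) \<omega> < 0"
          using card[of n] h2[of n] unfolding c_def by linarith
      qed
    qed
  qed
qed

end
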